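(* Every subcubic outerplanar graph is $(1^2,2^3)$-packing edge-colorable, that is, its edge set can be partitioned into two matchings and three induced matchings (classes may be empty).
   Context: Graphs are finite and simple. A graph is subcubic if its maximum degree is at most $3$. The distance between two distinct edges of a graph $G$ is their distance in the line graph of $G$, so edges sharing an endpoint are at distance $1$ (edges in different components are at infinite distance). For a non-decreasing sequence $S=(s_1,\dots,s_k)$ of positive integers, an $S$-packing edge-coloring of $G$ is a partition of $E(G)$ into (possibly empty) classes $E_1,\dots,E_k$ such that for each $i$ any two distinct edges in $E_i$ are at distance at least $s_i+1$. Exponents denote repetition: $(1^2,2^3)=(1,1,2,2,2)$. *)

theory Defs
  imports "HOL-Analysis.Analysis"
begin

type_synonym 'a graph = "'a set \<times> 'a set set"

abbreviation verts :: "'a graph \<Rightarrow> 'a set" where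
  "verts G \<equiv> fst G"

abbreviation edges :: "'a graph \<Rightarrow> 'a set set" where
  "edges G \<equiv> snd G"

definition finite_simple_graph :: "'a graph \<Rightarrow> bool" where
  "finite_simple_graph G \<longleftrightarrow>
     finite (verts G) \<and> (\<forall>e\<in>edges G. e \<subseteq> verts G \<and> card e = 2)"

definition degree :: "'a graph \<Rightarrow> 'a \<Rightarrow> nat" where
  "degree G v = card {e \<in> edges G. v \<in> e}"

definition subcubic :: "'a graph \<Rightarrow> bool" where
  "subcubic G \<longleftrightarrow> (\<forall>v\<in>verts G. degree G v \<le> 3)"

definition walk_between :: "'a graph \<Rightarrow> 'a \<Rightarrow> 'a list \<Rightarrow> 'a \<Rightarrow> bool" where
  "walk_between G u xs v \<longleftrightarrow>
     xs \<noteq> [] \<and> hd xs = u \<and> last xs = v \<and> set xs \<subseteq> verts G \<and>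
     successively (\<lambda>x y. {x, y} \<in> edges G) xs"

(* A walk is given by its list of vertices, so its length is one less than the
   length of the list.  The infimum over the empty set is \<infinity>. *)
definition graph_dist :: "'a graph \<Rightarrow> 'a \<Rightarrow> 'a \<Rightarrow> enat" where
  "graph_dist G u v = (INF xs \<in> {xs. walk_between G u xs v}. enat (length xs - 1))"

definition line_graph :: "'a graph \<Rightarrow> 'a set graph" where
  "line_graph G =
     (edges G, {{e, f} | e f. e \<in> edges G \<and> f \<in> edges G \<and> e \<noteq> f \<and> e \<inter> f \<noteq> {}})"

definition edge_dist :: "'a graph \<Rightarrow> 'a set \<Rightarrow> 'a set \<Rightarrow> enat" where
  "edge_dist G e f = graph_dist (line_graph G) e f"

(* Classes are indexed by their position in the list and may be empty. *)
definition edge_partition :: "'a graph \<Rightarrow> 'a set set list \<Rightarrow> bool" where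
  "edge_partition G Es \<longleftrightarrow>
     \<Union> (set Es) = edges G \<and> disjoint_family_on (\<lambda>i. Es ! i) {..<length Es}"

definition packing_edge_coloring :: "'a graph \<Rightarrow> nat list \<Rightarrow> 'a set set list \<Rightarrow> bool" where
  "packing_edge_coloring G S Es \<longleftrightarrow>
     sorted S \<and> (\<forall>s\<in>set S. 0 < s) \<and>
     length Es = length S \<and> edge_partition G Es \<and>
     (\<forall>i<length S. \<forall>e\<in>Es ! i. \<forall>f\<in>Es ! i. e \<noteq> f \<longrightarrow> enat (S ! i + 1) \<le> edge_dist G e f)"

definition packing_edge_colorable :: "'a graph \<Rightarrow> nat list \<Rightarrow> bool" where
  "packing_edge_colorable G S \<longleftrightarrow> (\<exists>Es. packing_edge_coloring G S Es)"

definition matching :: "'a graph \<Rightarrow> 'a set set \<Rightarrow> bool" where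
  "matching G M \<longleftrightarrow>
     M \<subseteq> edges G \<and> (\<forall>e\<in>M. \<forall>f\<in>M. e \<noteq> f \<longrightarrow> e \<inter> f = {})"

(* The subgraph induced by the endpoints of M has no edges other than those of M. *)
definition induced_matching :: "'a graph \<Rightarrow> 'a set set \<Rightarrow> bool" where
  "induced_matching G M \<longleftrightarrow> matching G M \<and> {e \<in> edges G. e \<subseteq> \<Union> M} = M"

definition arc_interior :: "(real \<Rightarrow> complex) \<Rightarrow> complex set" where
  "arc_interior g = path_image g - {pathstart g, pathfinish g}"

(* Plane drawing: vertices are distinct points, each edge is a simple arc joining
   its endpoints whose interior contains no vertex and no point of another edge. *)
definition plane_drawing ::
    "'a graph \<Rightarrow> ('a \<Rightarrow> complex) \<Rightarrow> ('a set \<Rightarrow> real \<Rightarrow> complex) \<Rightarrow> bool" where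
  "plane_drawing G p \<gamma> \<longleftrightarrow>
     inj_on p (verts G) \<and>
     (\<forall>e\<in>edges G. arc (\<gamma> e) \<and> {pathstart (\<gamma> e), pathfinish (\<gamma> e)} = p ` e \<and>
        arc_interior (\<gamma> e) \<inter> p ` verts G = {}) \<and>
     (\<forall>e\<in>edges G. \<forall>f\<in>edges G. e \<noteq> f \<longrightarrow> arc_interior (\<gamma> e) \<inter> path_image (\<gamma> f) = {})"

definition drawing_points ::
    "'a graph \<Rightarrow> ('a \<Rightarrow> complex) \<Rightarrow> ('a set \<Rightarrow> real \<Rightarrow> complex) \<Rightarrow> complex set" where
  "drawing_points G p \<gamma> = p ` verts G \<union> (\<Union>e\<in>edges G. path_image (\<gamma> e))"

(* For a finite graph the set of drawing points is compact, so its outside is the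
   unique unbounded component of the complement, that is, the outer face. *)
definition outerplanar :: "'a graph \<Rightarrow> bool" where
  "outerplanar G \<longleftrightarrow>
     (\<exists>p \<gamma>. plane_drawing G p \<gamma> \<and>
        (\<forall>v\<in>verts G. p v \<in> frontier (outside (drawing_points G p \<gamma>))))"

end

(* The argument works for every subcubic graph without K4 minor. If each of its edges meets at least
   three others, suppress the vertices of degree 2: by Dirac's theorem the resulting multigraph has
   parallel edges, which come from a 4-cycle to be removed or a triangle to be contracted. So by
   induction the graph is properly 3-edge-colourable. Two colour classes are the two matchings.
   Contracting the edges of the third class gives a graph without K4 minor, which is 3-colourable,
   again by Dirac's theorem; a 3-colouring splits the third class into induced matchings.

   An outerplanar graph has no K4 minor: otherwise six arcs join four points of the plane pairwise,
   and no vertex is inside one of the four triangles. So the insides of the triangles avoid the whole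
   drawing and are pairwise disjoint, whereas the winding numbers of the triangles cancel. *)

theory Submission
  imports Defs "HOL-Complex_Analysis.Winding_Numbers"
begin

section \<open>Minors and Dirac's theorem\<close>

text \<open>Minors replace drawings because the induction deletes and contracts; nothing has to be
  redrawn, and a drawing is used only once, to exclude the minor. An edge \<open>uv\<close> meets
  deg u + deg v - 2 others. If these are at most two, a colour is left for \<open>uv\<close> once
  the rest is coloured; otherwise all degree sums along edges are at least 5. Then no vertex has
  degree 1, and a vertex of degree 2 has only neighbours of degree 3, so an edge of the suppressed
  multigraph comes from a single edge or from a path of length 2. Two parallel ones cannot both be
  single edges: two paths form a 4-cycle, an edge and a path form a triangle. Contracting the
  triangle would merge two edges if its two corners of degree 3 had the same third neighbour. That
  case is treated by deletion instead. Two edges of the third colour class spoil an induced matching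
  exactly when some edge joins them, that is, when they become adjacent vertices in the contraction.
  This is why a vertex colouring of the contraction is what is needed.\<close>

definition connected_in :: "('a \<Rightarrow> 'a \<Rightarrow> bool) \<Rightarrow> 'a set \<Rightarrow> bool" where
  "connected_in R B \<longleftrightarrow> B \<noteq> {} \<and> (\<forall>x\<in>B. \<forall>y\<in>B. (\<lambda>u v. R u v \<and> u \<in> B \<and> v \<in> B)\<^sup>*\<^sup>* x y)"

text \<open>Stated for a relation on any type, since it is applied to three kinds of graph:
  \<open>adjacent E\<close>, the suppressed graph on the vertices of degree 3, and
  \<open>joined E\<close>, whose vertices are edges.\<close>

definition K4_minor :: "'a set \<Rightarrow> ('a \<Rightarrow> 'a \<Rightarrow> bool) \<Rightarrow> bool" where
  "K4_minor V R \<longleftrightarrow> (\<exists>B::nat \<Rightarrow> 'a set.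
     (\<forall>i<4. connected_in R (B i) \<and> B i \<subseteq> V) \<and>
     (\<forall>i<4. \<forall>j<4. i \<noteq> j \<longrightarrow> B i \<inter> B j = {} \<and> (\<exists>x\<in>B i. \<exists>y\<in>B j. R x y)))"

section \<open>Connected sets and the transfer of minors\<close>

lemma connected_in_singleton: "connected_in R {x}"
  by (simp add: connected_in_def)

lemma connected_in_centre:
  assumes "symp R" "c \<in> B"
    and "\<And>x. x \<in> B \<Longrightarrow> (\<lambda>u v. R u v \<and> u \<in> B \<and> v \<in> B)\<^sup>*\<^sup>* c x"
  shows "connected_in R B"
proof -
  let ?r = "\<lambda>u v. R u v \<and> u \<in> B \<and> v \<in> B"
  have "symp ?r"
    using assms(1) by (auto simp: symp_def)
  then have "symp ?r\<^sup>*\<^sup>*"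
    by (rule symp_rtranclp)
  then show ?thesis
    unfolding connected_in_def using assms(2,3) by (metis (no_types, lifting) empty_iff rtranclp_trans sympD)
qed

lemma connected_in_star:
  assumes "symp R" "c \<in> B" "\<And>x. x \<in> B \<Longrightarrow> x \<noteq> c \<Longrightarrow> R c x"
  shows "connected_in R B"
proof (rule connected_in_centre[OF assms(1,2)])
  fix x assume "x \<in> B"
  then show "(\<lambda>u v. R u v \<and> u \<in> B \<and> v \<in> B)\<^sup>*\<^sup>* c x"
    using assms(2,3) by (cases "x = c") (auto intro: r_into_rtranclp)
qed

lemma connected_in_interval:
  assumes "symp R" "successively R xs" "m < n" "n \<le> length xs"
  shows "connected_in R ((!) xs ` {m..<n})"
proof (rule connected_in_centre[OF assms(1)])
  show "xs ! m \<in> (!) xs ` {m..<n}"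
    using assms by auto
  fix x assume "x \<in> (!) xs ` {m..<n}"
  then obtain k where k: "m \<le> k" "k < n" "x = xs ! k"
    by auto
  let ?r = "\<lambda>u v. R u v \<and> u \<in> (!) xs ` {m..<n} \<and> v \<in> (!) xs ` {m..<n}"
  have "?r\<^sup>*\<^sup>* (xs ! m) (xs ! k)"
    using k(1,2)
  proof (induction k rule: dec_induct)
    case base
    then show ?case by simp
  next
    case (step k)
    then have "R (xs ! k) (xs ! Suc k)"
      using assms(2,4) by (simp add: successively_conv_nth)
    then have "?r (xs ! k) (xs ! Suc k)"
      using step by auto
    moreover have "?r\<^sup>*\<^sup>* (xs ! m) (xs ! k)"
      using step.IH step.prems by simp
    ultimately show ?case
      by (rule rtranclp.rtrancl_into_rtrancl[rotated])
  qed
  then show "?r\<^sup>*\<^sup>* (xs ! m) x"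
    using k by simp
qed

text \<open>A path in \<open>B\<close> lifts: walk inside one set \<open>\<phi> b\<close> to an end
  of a crossing edge, cross to the next set, and go on.\<close>

lemma connected_in_UN:
  assumes S: "connected_in S B"
    and con: "\<And>b. b \<in> B \<Longrightarrow> connected_in R (\<phi> b)"
    and adj: "\<And>b b'. b \<in> B \<Longrightarrow> b' \<in> B \<Longrightarrow> S b b' \<Longrightarrow> \<exists>x\<in>\<phi> b. \<exists>y\<in>\<phi> b'. R x y"
  shows "connected_in R (\<Union>b\<in>B. \<phi> b)"
proof -
  let ?U = "\<Union>b\<in>B. \<phi> b"
  let ?r = "\<lambda>u v. R u v \<and> u \<in> ?U \<and> v \<in> ?U"
  let ?s = "\<lambda>u v. S u v \<and> u \<in> B \<and> v \<in> B"
  have inner: "?r\<^sup>*\<^sup>* x y" if "b \<in> B" "x \<in> \<phi> b" "y \<in> \<phi> b" for b x y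
  proof -
    have "(\<lambda>u v. R u v \<and> u \<in> \<phi> b \<and> v \<in> \<phi> b)\<^sup>*\<^sup>* x y"
      using con[OF that(1)] that by (auto simp: connected_in_def)
    then show ?thesis
      by (rule mono_rtranclp[rule_format, rotated]) (use that in auto)
  qed
  have "\<forall>x\<in>\<phi> b. \<forall>y\<in>\<phi> b'. ?r\<^sup>*\<^sup>* x y" if "?s\<^sup>*\<^sup>* b b'" "b \<in> B" for b b'
    using that
  proof (induction rule: rtranclp_induct)
    case base
    then show ?case using inner by blast
  next
    case (step b' b'')
    then obtain x' y' where xy: "x' \<in> \<phi> b'" "y' \<in> \<phi> b''" "R x' y'"
      using adj[of b' b''] by auto
    show ?case
    proof (intro ballI)
      fix x y assume "x \<in> \<phi> b" "y \<in> \<phi> b''"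
      have "b' \<in> B" "b'' \<in> B"
        using step.hyps by simp_all
      have "?r\<^sup>*\<^sup>* x x'"
        using step.IH step.prems xy(1) \<open>x \<in> \<phi> b\<close> by simp
      also have "?r x' y'"
        using xy \<open>b' \<in> B\<close> \<open>b'' \<in> B\<close> by auto
      also have "?r\<^sup>*\<^sup>* y' y"
        using \<open>b'' \<in> B\<close> xy(2) \<open>y \<in> \<phi> b''\<close> by (rule inner)
      finally show "?r\<^sup>*\<^sup>* x y" .
    qed
  qed
  moreover have "?s\<^sup>*\<^sup>* b b'" if "b \<in> B" "b' \<in> B" for b b'
    using S that by (auto simp: connected_in_def)
  moreover have "?U \<noteq> {}"
    using S con by (auto simp: connected_in_def)
  ultimately show ?thesis
    unfolding connected_in_def by (metis (no_types, lifting) UN_E)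
qed

text \<open>The minor relation is transitive: merging the sets \<open>\<phi> b\<close> over a branch
  set gives a branch set. Subgraphs, suppression of vertices and both kinds of contraction are all
  handled by a choice of \<open>\<phi>\<close>.\<close>

lemma K4_minor_model:
  assumes "K4_minor V S"
    and con: "\<And>b. b \<in> V \<Longrightarrow> connected_in R (\<phi> b) \<and> \<phi> b \<subseteq> W"
    and dis: "\<And>b b'. b \<in> V \<Longrightarrow> b' \<in> V \<Longrightarrow> b \<noteq> b' \<Longrightarrow> \<phi> b \<inter> \<phi> b' = {}"
    and adj: "\<And>b b'. b \<in> V \<Longrightarrow> b' \<in> V \<Longrightarrow> S b b' \<Longrightarrow> \<exists>x\<in>\<phi> b. \<exists>y\<in>\<phi> b'. R x y"
  shows "K4_minor W R"
proof -
  obtain B :: "nat \<Rightarrow> _" where B: "\<And>i. i < 4 \<Longrightarrow> connected_in S (B i) \<and> B i \<subseteq> V"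
    "\<And>i j. i < 4 \<Longrightarrow> j < 4 \<Longrightarrow> i \<noteq> j \<Longrightarrow> B i \<inter> B j = {} \<and> (\<exists>x\<in>B i. \<exists>y\<in>B j. S x y)"
    using assms(1) unfolding K4_minor_def by blast
  show ?thesis
    unfolding K4_minor_def
  proof (intro exI[of _ "\<lambda>i. \<Union>b\<in>B i. \<phi> b"] conjI allI impI)
    fix i :: nat assume i: "i < 4"
    show "connected_in R (\<Union>b\<in>B i. \<phi> b)"
      using B(1)[OF i] con adj by (intro connected_in_UN[where S = S]) blast+
    show "(\<Union>b\<in>B i. \<phi> b) \<subseteq> W"
      using B(1)[OF i] con by blast
    fix j :: nat assume j: "j < 4" "i \<noteq> j"
    show "(\<Union>b\<in>B i. \<phi> b) \<inter> (\<Union>b\<in>B j. \<phi> b) = {}"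
    proof -
      have "\<phi> b \<inter> \<phi> b' = {}" if "b \<in> B i" "b' \<in> B j" for b b'
        by (rule dis) (use that B(1)[OF i] B(1)[OF j(1)] B(2)[OF i j] in auto)
      then show ?thesis by blast
    qed
    obtain b b' where "b \<in> B i" "b' \<in> B j" "S b b'"
      using B(2)[OF i j] by blast
    then show "\<exists>x\<in>\<Union> (\<phi> ` B i). \<exists>y\<in>\<Union> (\<phi> ` B j). R x y"
      using adj[of b b'] B(1)[OF i] B(1)[OF j(1)] by blast
  qed
qed

text \<open>The branch sets are four consecutive segments of the path, the second being the single
  vertex \<open>xs ! (i - 1)\<close>. Path edges join neighbouring segments, and the three chords
  join the first to the third, the first to the fourth and the second to the fourth.\<close>

lemma path_chords_K4_minor:
  assumes R: "symp R" and xs: "successively R xs" "distinct xs" "set xs \<subseteq> V"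
    and idx: "2 \<le> i" "i < j" "i < k" "j < length xs" "k < length xs"
    and chords: "R (xs ! 0) (xs ! i)" "R (xs ! 0) (xs ! j)" "R (xs ! (i - 1)) (xs ! k)"
  shows "K4_minor V R"
proof -
  \<comment> \<open>Cutting at the smaller of \<open>j\<close> and \<open>k\<close> puts both chord
    ends into the last segment, in whichever order they come; \<open>j = k\<close> is
    allowed.\<close>
  define lo hi where "lo = min j k" and "hi = max j k"
  define B where "B = (\<lambda>n::nat. (!) xs ` (if n = 0 then {0..<i - 1} else if n = 1 then {i - 1..<i}
     else if n = 2 then {i..<lo} else {lo..<Suc hi}))"
  have four: "n < 4 \<longleftrightarrow> n = 0 \<or> n = 1 \<or> n = 2 \<or> n = 3" for n :: nat
    by auto
  have ord: "0 < i - 1" "i - 1 < i" "i < lo" "lo < Suc hi" "Suc hi \<le> length xs"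
    using idx by (auto simp: lo_def hi_def)
  have con: "connected_in R (B n)" if "n < 4" for n
  proof -
    have "connected_in R ((!) xs ` {0..<i - 1})" "connected_in R ((!) xs ` {i - 1..<i})"
      "connected_in R ((!) xs ` {i..<lo})" "connected_in R ((!) xs ` {lo..<Suc hi})"
      using ord by (auto intro!: connected_in_interval[OF R xs(1)])
    then show ?thesis
      by (simp add: B_def)
  qed
  have sub: "B n \<subseteq> V" for n
  proof -
    have "B n \<subseteq> set xs"
      using ord by (auto simp: B_def)
    then show ?thesis using xs(3) by blast
  qed
  have inj: "inj_on ((!) xs) {..<length xs}"
    using xs(2) by (simp add: inj_on_nth)
  have dis: "B m \<inter> B n = {}" if "m < n" "n < 4" for m n
    unfolding B_def
    by (subst inj_on_image_Int[OF inj, symmetric]) (use that ord in \<open>auto simp: four\<close>)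
  have step: "R (xs ! n) (xs ! Suc n)" if "Suc n < length xs" for n
    using xs(1) that by (simp add: successively_conv_nth)
  have mem: "xs ! 0 \<in> B 0" "xs ! (i - 2) \<in> B 0" "xs ! (i - 1) \<in> B 1" "xs ! i \<in> B 2" "xs ! (lo - 1) \<in> B 2"
    "xs ! lo \<in> B 3" "xs ! j \<in> B 3" "xs ! k \<in> B 3"
    using ord idx by (auto simp: B_def lo_def hi_def intro!: imageI)
  have "R (xs ! (i - 2)) (xs ! (i - 1))" "R (xs ! (i - 1)) (xs ! i)" "R (xs ! (lo - 1)) (xs ! lo)"
    using step[of "i - 2"] step[of "i - 1"] step[of "lo - 1"] ord idx by (auto simp: Suc_diff_Suc numeral_2_eq_2)
  then have touch: "\<exists>x\<in>B m. \<exists>y\<in>B n. R x y" if "m < n" "n < 4" for m n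
  proof -
    have "m = 0 \<and> n = 1 \<or> m = 0 \<and> n = 2 \<or> m = 0 \<and> n = 3 \<or> m = 1 \<and> n = 2 \<or> m = 1 \<and> n = 3 \<or> m = 2 \<and> n = 3"
      using that by auto
    then show ?thesis
      using mem chords \<open>R (xs ! (i - 2)) (xs ! (i - 1))\<close> \<open>R (xs ! (i - 1)) (xs ! i)\<close> \<open>R (xs ! (lo - 1)) (xs ! lo)\<close>
      by auto
  qed
  have "B m \<inter> B n = {} \<and> (\<exists>x\<in>B m. \<exists>y\<in>B n. R x y)" if "m < 4" "n < 4" "m \<noteq> n" for m n
  proof (cases "m < n")
    case True
    then show ?thesis using dis touch that by blast
  next
    case False
    then have "n < m" using that by simp
    then have "B n \<inter> B m = {}" "\<exists>x\<in>B n. \<exists>y\<in>B m. R x y"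
      using dis touch that by blast+
    then show ?thesis
      using R by (metis Int_commute sympD)
  qed
  then show ?thesis
    unfolding K4_minor_def using con sub by blast
qed

text \<open>Take a longest path \<open>x\<^sub>0 x\<^sub>1 \<dots>\<close> and a chord from \<open>x\<^sub>0\<close> to \<open>x\<^sub>i\<close> with
  \<open>i \<ge> 2\<close> as small as possible over all longest paths. Rotating at this chord gives a longest
  path that starts in \<open>x\<^bsub>i - 1\<^esub>\<close>; by the choice of \<open>i\<close>, the third neighbours of
  \<open>x\<^sub>0\<close> and \<open>x\<^bsub>i - 1\<^esub>\<close> both lie beyond \<open>x\<^sub>i\<close>.\<close>

lemma min_degree_3_K4_minor:
  assumes V: "finite V" "V \<noteq> {}" and R: "symp R" "irreflp R"
    and deg: "\<And>v. v \<in> V \<Longrightarrow> 3 \<le> card {u \<in> V. R v u}"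
  shows "K4_minor V R"
proof -
  define P where "P = {xs. distinct xs \<and> set xs \<subseteq> V \<and> successively R xs}"
  have bound: "length xs < Suc (card V)" if "xs \<in> P" for xs
    using that V(1) card_mono[of V "set xs"] by (auto simp: P_def distinct_card less_Suc_eq_le)
  have "[] \<in> P"
    by (simp add: P_def)
  then obtain xs0 where xs0: "xs0 \<in> P" "\<And>ys. ys \<in> P \<Longrightarrow> length ys \<le> length xs0"
    using ex_has_greatest_nat[of "\<lambda>xs. xs \<in> P" "[]" length "Suc (card V)"] bound by blast
  define L where "L = {xs \<in> P. length xs = length xs0}"
  obtain v where "v \<in> V" using V by blast
  then have "[v] \<in> P" by (simp add: P_def)
  then have ne: "xs \<noteq> []" if "xs \<in> L" for xs
    using xs0(2)[of "[v]"] that by (auto simp: L_def)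
  \<comment> \<open>A longest path cannot be prolonged, so all neighbours of its first vertex lie on
    it. By the degree bound one of them differs from \<open>xs ! 1\<close> and from
    \<open>xs ! i\<close>; later, \<open>i\<close> is the end of the shortest chord.\<close>
  have nbr: "\<exists>j. 2 \<le> j \<and> j < length xs \<and> j \<noteq> i \<and> R (xs ! 0) (xs ! j)" if "xs \<in> L" for xs i
  proof (rule ccontr)
    assume no: "\<not> ?thesis"
    have xs: "distinct xs" "set xs \<subseteq> V" "successively R xs" "xs \<noteq> []"
      using that ne by (auto simp: L_def P_def)
    have "{u \<in> V. R (xs ! 0) u} \<subseteq> {xs ! 1, xs ! i}"
    proof
      fix u assume u: "u \<in> {u \<in> V. R (xs ! 0) u}"
      have "u \<in> set xs"
      proof (rule ccontr)
        assume "u \<notin> set xs"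
        then have "u # xs \<in> P"
          using u xs R(1) by (auto simp: P_def successively_Cons hd_conv_nth dest: sympD)
        then show False
          using xs0(2)[of "u # xs"] that by (simp add: L_def)
      qed
      then obtain j where j: "j < length xs" "u = xs ! j"
        by (auto simp: in_set_conv_nth)
      then have "j \<noteq> 0"
        using u R(2) by (metis (mono_tags, lifting) irreflpD mem_Collect_eq)
      then show "u \<in> {xs ! 1, xs ! i}"
        using no j u by (cases "j = 1") auto
    qed
    then have "card {u \<in> V. R (xs ! 0) u} \<le> card {xs ! 1, xs ! i}"
      by (intro card_mono) auto
    also have "\<dots> \<le> 2"
      by (simp add: card_insert_if)
    finally have "card {u \<in> V. R (xs ! 0) u} \<le> 2" .
    moreover have "xs ! 0 \<in> V"
      using xs(2,4) by auto
    ultimately show False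
      using deg[of "xs ! 0"] by simp
  qed
  define Q where "Q = (\<lambda>i. \<exists>xs\<in>L. 2 \<le> i \<and> i < length xs \<and> R (xs ! 0) (xs ! i))"
  have "xs0 \<in> L"
    using xs0 by (simp add: L_def)
  then have "\<exists>i. Q i"
    using nbr[of xs0 0] by (auto simp: Q_def)
  define i where "i = (LEAST i. Q i)"
  have "Q i"
    unfolding i_def using \<open>\<exists>i. Q i\<close> by (rule LeastI_ex)
  have least: "i \<le> j" if "Q j" for j
    unfolding i_def using that by (rule Least_le)
  obtain xs where xs: "xs \<in> L" "2 \<le> i" "i < length xs" "R (xs ! 0) (xs ! i)"
    using \<open>Q i\<close> by (auto simp: Q_def)
  then have xsP: "distinct xs" "set xs \<subseteq> V" "successively R xs"
    by (auto simp: L_def P_def)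
  obtain j where j: "2 \<le> j" "j < length xs" "j \<noteq> i" "R (xs ! 0) (xs ! j)"
    using nbr[OF xs(1)] by blast
  then have "i < j"
    using least[of j] xs(1) unfolding Q_def by force
  \<comment> \<open>Reversing the part before \<open>i\<close> changes no position from
    \<open>i\<close> on. So a chord from the start of \<open>ys\<close> to a position
    \<open>k > i\<close> joins \<open>xs ! (i - 1)\<close> to \<open>xs ! k\<close>.\<close>
  define ys where "ys = rev (take i xs) @ drop i xs"
  have ys_nth: "ys ! n = xs ! n" if "i \<le> n" "n < length xs" for n
    using that xs by (simp add: ys_def nth_append)
  have ys0: "ys ! 0 = xs ! (i - 1)"
    using xs by (simp add: ys_def nth_append rev_nth)
  have "set ys = set (take i xs @ drop i xs)"
    by (simp only: ys_def set_append set_rev)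
  then have "set ys = set xs"
    by (simp only: append_take_drop_id)
  moreover have "distinct ys" "length ys = length xs"
    unfolding ys_def using xsP(1) xs by (auto simp: set_take_disj_set_drop_if_distinct)
  moreover have "successively R ys"
  proof -
    have "successively R (take i xs @ drop i xs)"
      using xsP by simp
    then have *: "successively R (take i xs)" "successively R (drop i xs)"
      unfolding successively_append_iff by blast+
    have "successively R (rev (take i xs))"
      unfolding successively_rev using *(1) by (rule successively_mono) (use R(1) in \<open>auto dest: sympD\<close>)
    moreover have "last (rev (take i xs)) = xs ! 0" "hd (drop i xs) = xs ! i"
      using xs by (auto simp: last_rev hd_drop_conv_nth intro: hd_conv_nth)
    ultimately show ?thesis
      unfolding ys_def successively_append_iff using * xs(4) by simp
  qed
  ultimately have "ys \<in> L"
    using xs(1) by (auto simp: L_def P_def)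
  then obtain k where k: "2 \<le> k" "k < length ys" "k \<noteq> i" "R (ys ! 0) (ys ! k)"
    using nbr by blast
  then have "i < k"
    using least[of k] \<open>ys \<in> L\<close> unfolding Q_def by force
  then have "R (xs ! (i - 1)) (xs ! k)"
    using k ys_nth ys0 \<open>length ys = length xs\<close> by simp
  then show ?thesis
    using path_chords_K4_minor[OF R(1) xsP(3,1,2) xs(2) \<open>i < j\<close> \<open>i < k\<close> j(2) _ xs(4) j(4)] k
      \<open>length ys = length xs\<close> by simp
qed

text \<open>Greedy colouring: remove a vertex with at most two neighbours, colour the rest, and give
  the vertex a colour that its neighbours miss. The degree condition concerns all subsets so that it
  survives the removal.\<close>

lemma degenerate_3_colouring:
  fixes R :: "'a \<Rightarrow> 'a \<Rightarrow> bool"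
  assumes "finite V" "symp R"
    and "\<And>W. W \<subseteq> V \<Longrightarrow> W \<noteq> {} \<Longrightarrow> \<exists>v\<in>W. card {u \<in> W. R v u} \<le> 2"
  shows "\<exists>c::'a \<Rightarrow> nat. (\<forall>v\<in>V. c v < 3) \<and> (\<forall>u\<in>V. \<forall>v\<in>V. u \<noteq> v \<longrightarrow> R u v \<longrightarrow> c u \<noteq> c v)"
  using assms(1,3)
proof (induction V rule: finite_psubset_induct)
  case (psubset V)
  show ?case
  proof (cases "V = {}")
    case False
    then obtain v where v: "v \<in> V" "card {u \<in> V. R v u} \<le> 2"
      using psubset.prems[of V] by blast
    obtain c :: "'a \<Rightarrow> nat" where c: "\<forall>u\<in>V - {v}. c u < 3"
      "\<forall>u\<in>V - {v}. \<forall>w\<in>V - {v}. u \<noteq> w \<longrightarrow> R u w \<longrightarrow> c u \<noteq> c w"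
    proof -
      have sub: "V - {v} \<subset> V" using v(1) by blast
      have "\<exists>v\<in>W. card {u \<in> W. R v u} \<le> 2" if "W \<subseteq> V - {v}" "W \<noteq> {}" for W
        by (rule psubset.prems) (use that in auto)
      then have "\<exists>c::'a \<Rightarrow> nat. (\<forall>u\<in>V - {v}. c u < 3) \<and>
          (\<forall>u\<in>V - {v}. \<forall>w\<in>V - {v}. u \<noteq> w \<longrightarrow> R u w \<longrightarrow> c u \<noteq> c w)"
        by (rule psubset.IH[OF sub])
      then show ?thesis
        by (elim exE conjE) (rule that)
    qed
    have "card (c ` {u \<in> V. R v u}) \<le> card {u \<in> V. R v u}"
      using psubset.hyps by (intro card_image_le) simp
    then have "card (c ` {u \<in> V. R v u}) \<le> 2"
      using v(2) by simp
    then have "\<not> {..<3} \<subseteq> c ` {u \<in> V. R v u}"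
      using psubset.hyps card_mono[of "c ` {u \<in> V. R v u}" "{..<3}"] by auto
    then obtain a where a: "a < 3" "a \<notin> c ` {u \<in> V. R v u}"
      by blast
    show ?thesis
    proof (intro exI[of _ "c(v := a)"] conjI ballI impI)
      fix u assume "u \<in> V"
      then show "(c(v := a)) u < 3" using a c by auto
    next
      fix u w assume uw: "u \<in> V" "w \<in> V" "u \<noteq> w" "R u w"
      have "R w u" using uw(4) assms(2) by (auto dest: sympD)
      then have "u = v \<Longrightarrow> c w \<noteq> a" "w = v \<Longrightarrow> c u \<noteq> a"
        using a(2) uw by auto
      moreover have "u \<noteq> v \<Longrightarrow> w \<noteq> v \<Longrightarrow> c u \<noteq> c w"
        using c(2) uw by blast
      ultimately show "(c(v := a)) u \<noteq> (c(v := a)) w" using uw(3) by auto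
    qed
  qed simp
qed

section \<open>Edge colourings\<close>

abbreviation adjacent :: "'a set set \<Rightarrow> 'a \<Rightarrow> 'a \<Rightarrow> bool" where
  "adjacent E x y \<equiv> {x, y} \<in> E"

lemma symp_adjacent: "symp (adjacent E)"
  by (auto simp: symp_def insert_commute)

definition nbrs :: "'a set set \<Rightarrow> 'a \<Rightarrow> 'a set" where
  "nbrs E x = {y. {x, y} \<in> E}"

text \<open>The class on which the induction runs. A graph is reduced to its edge set, with vertex
  set \<open>\<Union>E\<close>, because only edges are coloured and isolated vertices vanish by
  themselves.\<close>

definition subcubic_K4_free :: "'a set set \<Rightarrow> bool" where
  "subcubic_K4_free E \<longleftrightarrow> finite E \<and> (\<forall>e\<in>E. card e = 2) \<and> (\<forall>x. card (nbrs E x) \<le> 3) \<and>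
     \<not> K4_minor (\<Union>E) (adjacent E)"

definition edge_3_colouring :: "'a set set \<Rightarrow> ('a set \<Rightarrow> nat) \<Rightarrow> bool" where
  "edge_3_colouring E c \<longleftrightarrow>
     (\<forall>e\<in>E. c e < 3) \<and> (\<forall>e\<in>E. \<forall>f\<in>E. e \<noteq> f \<longrightarrow> e \<inter> f \<noteq> {} \<longrightarrow> c e \<noteq> c f)"

lemma nbrs_sym: "y \<in> nbrs E x \<longleftrightarrow> x \<in> nbrs E y"
  by (simp add: nbrs_def insert_commute)

lemma nbrs_subset: "nbrs E x \<subseteq> \<Union>E"
  by (auto simp: nbrs_def)

lemma finite_Union_edges: "finite E \<Longrightarrow> \<forall>e\<in>E. card e = 2 \<Longrightarrow> finite (\<Union>E)"
  by (metis card.infinite finite_Union zero_neq_numeral)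

lemma finite_nbrs: "finite E \<Longrightarrow> \<forall>e\<in>E. card e = 2 \<Longrightarrow> finite (nbrs E x)"
  using finite_Union_edges nbrs_subset finite_subset by metis

lemma self_notin_nbrs: "\<forall>e\<in>E. card e = 2 \<Longrightarrow> x \<notin> nbrs E x"
  by (auto simp: nbrs_def)

lemma edge_eq:
  assumes "\<forall>e\<in>E. card e = 2" "e \<in> E" "x \<in> e"
  shows "\<exists>y\<in>nbrs E x. y \<noteq> x \<and> e = {x, y}"
proof -
  obtain u v where uv: "e = {u, v}" "u \<noteq> v"
    using assms(1,2) by (auto simp: card_2_iff)
  then show ?thesis
    using assms(2,3) by (auto simp: nbrs_def insert_commute)
qed

lemma notin_edge:
  assumes "\<forall>e\<in>E. card e = 2" "e \<in> E - F" "\<And>y. y \<in> nbrs E x \<Longrightarrow> {x, y} \<in> F"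
  shows "x \<notin> e"
  using edge_eq[OF assms(1), of e x] assms(2,3) by auto

lemma star_eq: "\<forall>e\<in>E. card e = 2 \<Longrightarrow> {e \<in> E. x \<in> e} = (\<lambda>y. {x, y}) ` nbrs E x"
  using edge_eq[of E _ x] by (auto simp: nbrs_def)

lemma K4_minor_mono:
  assumes "K4_minor V R" "V \<subseteq> W" "\<And>x y. x \<in> V \<Longrightarrow> y \<in> V \<Longrightarrow> R x y \<Longrightarrow> R' x y"
  shows "K4_minor W R'"
  by (rule K4_minor_model[OF assms(1), where \<phi> = "\<lambda>x. {x}"])
     (use assms(2,3) in \<open>auto simp: connected_in_singleton\<close>)

lemma subcubic_K4_free_subset:
  assumes "subcubic_K4_free E" "F \<subseteq> E"
  shows "subcubic_K4_free F"
proof -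
  have E: "finite E" "\<forall>e\<in>E. card e = 2" "\<And>x. card (nbrs E x) \<le> 3" "\<not> K4_minor (\<Union>E) (adjacent E)"
    using assms(1) by (auto simp: subcubic_K4_free_def)
  have "card (nbrs F x) \<le> card (nbrs E x)" for x
    using assms(2) by (intro card_mono finite_nbrs E) (auto simp: nbrs_def)
  then have "card (nbrs F x) \<le> 3" for x
    using E(3) le_trans by blast
  moreover have "\<not> K4_minor (\<Union>F) (adjacent F)"
    using E(4) K4_minor_mono[of "\<Union>F" "adjacent F" "\<Union>E" "adjacent E"] assms(2) by blast
  ultimately show ?thesis
    using E(1,2) assms(2) by (auto simp: subcubic_K4_free_def intro: finite_subset)
qed

text \<open>Each reduction ends here: \<open>c\<close> colours what was left, \<open>d\<close>
  colours what was removed, and conflicts can arise only at vertices common to both.\<close>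

lemma edge_3_colouring_Un:
  assumes "edge_3_colouring E c" "edge_3_colouring F d" "E \<inter> F = {}"
    and "\<And>e f x. e \<in> E \<Longrightarrow> f \<in> F \<Longrightarrow> x \<in> e \<Longrightarrow> x \<in> f \<Longrightarrow> c e \<noteq> d f"
  shows "\<exists>c. edge_3_colouring (E \<union> F) c"
proof
  let ?c = "\<lambda>e. if e \<in> F then d e else c e"
  have c: "?c e = c e" if "e \<in> E" for e
    using assms(3) that by auto
  show "edge_3_colouring (E \<union> F) ?c"
    unfolding edge_3_colouring_def
  proof (intro conjI ballI impI)
    fix e assume "e \<in> E \<union> F"
    then show "?c e < 3"
      using assms(1,2) by (auto simp: edge_3_colouring_def)
    fix f assume "f \<in> E \<union> F" "e \<noteq> f" "e \<inter> f \<noteq> {}"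
    then obtain x where x: "x \<in> e" "x \<in> f" by blast
    consider "e \<in> F" "f \<in> F" | "e \<in> E" "f \<in> F" | "e \<in> F" "f \<in> E" | "e \<in> E" "f \<in> E"
      using \<open>e \<in> E \<union> F\<close> \<open>f \<in> E \<union> F\<close> by blast
    then show "?c e \<noteq> ?c f"
    proof cases
      case 1
      then show ?thesis using assms(2) \<open>e \<noteq> f\<close> \<open>e \<inter> f \<noteq> {}\<close> by (auto simp: edge_3_colouring_def)
    next
      case 2
      then show ?thesis using assms(4)[of e f x] x c by simp
    next
      case 3
      then have "c f \<noteq> d e" using assms(4)[of f e x] x by simp
      then show ?thesis using 3 c[of f] by simp
    next
      case 4
      then show ?thesis using assms(1) \<open>e \<noteq> f\<close> \<open>e \<inter> f \<noteq> {}\<close> c by (simp add: edge_3_colouring_def)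
    qed
  qed
qed

text \<open>The other edges at \<open>u\<close> and \<open>v\<close>, collected in \<open>X\<close>,
  number at most two, so one of three colours is free for \<open>uv\<close>.\<close>

lemma extend_light_edge:
  assumes E: "finite E" "\<forall>e\<in>E. card e = 2" and uv: "{u, v} \<in> E"
    and light: "card (nbrs E u) + card (nbrs E v) \<le> 4"
    and c: "edge_3_colouring (E - {{u, v}}) c"
  shows "\<exists>c. edge_3_colouring E c"
proof -
  define X where "X = (\<lambda>y. {u, y}) ` (nbrs E u - {v}) \<union> (\<lambda>y. {v, y}) ` (nbrs E v - {u})"
  have fin: "finite (nbrs E u)" "finite (nbrs E v)"
    using finite_nbrs[OF E] by auto
  have mem: "v \<in> nbrs E u" "u \<in> nbrs E v"
    using uv by (auto simp: nbrs_def insert_commute)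
  have "finite X"
    using fin by (simp add: X_def)
  have "card (c ` X) \<le> card X"
    using \<open>finite X\<close> by (rule card_image_le)
  also have "\<dots> \<le> card ((\<lambda>y. {u, y}) ` (nbrs E u - {v})) + card ((\<lambda>y. {v, y}) ` (nbrs E v - {u}))"
    unfolding X_def by (rule card_Un_le)
  also have "\<dots> \<le> card (nbrs E u - {v}) + card (nbrs E v - {u})"
    using fin by (intro add_mono card_image_le) auto
  also have "\<dots> = (card (nbrs E u) - 1) + (card (nbrs E v) - 1)"
    using mem fin by simp
  finally have "card (c ` X) \<le> 2"
    using light mem fin card_gt_0_iff[of "nbrs E u"] card_gt_0_iff[of "nbrs E v"] by auto
  then have "\<not> {..<3} \<subseteq> c ` X"
    using \<open>finite X\<close> card_mono[of "c ` X" "{..<3}"] by auto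
  then obtain a where a: "a < 3" "a \<notin> c ` X"
    by blast
  have "e \<in> X" if "e \<in> E - {{u, v}}" "x \<in> e" "x \<in> {u, v}" for e x
    using edge_eq[OF E(2), of e x] that by (auto simp: X_def insert_commute)
  then have "\<exists>c. edge_3_colouring (E - {{u, v}} \<union> {{u, v}}) c"
    using a by (intro edge_3_colouring_Un[OF c, of _ "\<lambda>_. a"]) (auto simp: edge_3_colouring_def)
  then show ?thesis
    using uv by (simp add: insert_absorb)
qed

text \<open>Suppressing the vertices of degree 2 yields a multigraph on the vertices of degree 3. Its
  underlying simple graph has a vertex of degree at most 2 by Dirac's theorem, so some pair of
  parallel edges arises; they come from a 4-cycle or from a triangle.\<close>

lemma reducible_configuration:
  assumes good: "subcubic_K4_free E" and "E \<noteq> {}"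
    and heavy: "\<forall>u v. {u, v} \<in> E \<longrightarrow> 5 \<le> card (nbrs E u) + card (nbrs E v)"
  obtains u v w w' where "u \<noteq> v" "w \<noteq> w'" "nbrs E w = {u, v}" "nbrs E w' = {u, v}"
    | u v w where "{u, v} \<in> E" "nbrs E w = {u, v}" "card (nbrs E u) = 3" "card (nbrs E v) = 3"
proof -
  have E: "finite E" "\<forall>e\<in>E. card e = 2" "\<And>x. card (nbrs E x) \<le> 3" "\<not> K4_minor (\<Union>E) (adjacent E)"
    using good by (auto simp: subcubic_K4_free_def)
  define V where "V = {v. card (nbrs E v) = 3}"
  define S where "S u v \<longleftrightarrow> u \<in> V \<and> v \<in> V \<and> u \<noteq> v \<and> ({u, v} \<in> E \<or> (\<exists>w. nbrs E w = {u, v}))" for u v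
  have VE: "V \<subseteq> \<Union>E"
  proof
    fix v assume "v \<in> V"
    then have "nbrs E v \<noteq> {}" by (auto simp: V_def)
    then show "v \<in> \<Union>E" by (auto simp: nbrs_def)
  qed
  then have "finite V"
    using finite_Union_edges[OF E(1,2)] finite_subset by blast
  have "V \<noteq> {}"
  proof -
    obtain e where "e \<in> E" using \<open>E \<noteq> {}\<close> by blast
    then obtain u v where "{u, v} \<in> E" using E(2) by (metis card_2_iff)
    from heavy[rule_format, OF this] E(3)[of u] E(3)[of v] have "card (nbrs E u) = 3 \<or> card (nbrs E v) = 3"
      by linarith
    then show ?thesis by (auto simp: V_def)
  qed
  have "symp S" "irreflp S"
    by (auto simp: S_def symp_def irreflp_def insert_commute)
  have "\<not> K4_minor V S"
  proof
    assume minor: "K4_minor V S"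
    \<comment> \<open>Each vertex of degree 2 is assigned to one of its two neighbours, and
      \<open>\<phi> u\<close> is \<open>u\<close> with the vertices assigned to it. If
      \<open>w\<close> links \<open>u\<close> and \<open>v\<close>, it belongs to one of their stars
      and is adjacent to the centre of the other.\<close>
    define f where "f w = (SOME u. u \<in> nbrs E w)" for w
    define \<phi> where "\<phi> u = insert u {w. card (nbrs E w) = 2 \<and> f w = u}" for u
    have f: "f w \<in> nbrs E w" if "card (nbrs E w) = 2" for w
    proof -
      have "nbrs E w \<noteq> {}" using that by auto
      then show ?thesis unfolding f_def by (simp add: some_in_eq)
    qed
    have "K4_minor (\<Union>E) (adjacent E)"
    proof (rule K4_minor_model[OF minor, where \<phi> = \<phi>])
      fix u assume u: "u \<in> V"
      have "connected_in (adjacent E) (\<phi> u)"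
        by (rule connected_in_star[OF symp_adjacent, of u])
           (use f in \<open>auto simp: \<phi>_def nbrs_def insert_commute\<close>)
      moreover have "\<phi> u \<subseteq> \<Union>E"
        using u VE f by (auto simp: \<phi>_def nbrs_def)
      ultimately show "connected_in (adjacent E) (\<phi> u) \<and> \<phi> u \<subseteq> \<Union>E" ..
      fix v assume v: "v \<in> V"
      show "\<phi> u \<inter> \<phi> v = {}" if "u \<noteq> v"
        using that u v by (auto simp: \<phi>_def V_def)
      assume "S u v"
      then have uv: "u \<noteq> v" and "{u, v} \<in> E \<or> (\<exists>w. nbrs E w = {u, v})"
        by (auto simp: S_def)
      then show "\<exists>x\<in>\<phi> u. \<exists>y\<in>\<phi> v. {x, y} \<in> E"
      proof (elim disjE exE)
        assume "{u, v} \<in> E"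
        then show ?thesis by (auto simp: \<phi>_def)
      next
        fix w assume w: "nbrs E w = {u, v}"
        then have "card (nbrs E w) = 2" using uv by simp
        moreover have "{w, u} \<in> E" "{w, v} \<in> E"
          using w by (auto simp: nbrs_def)
        moreover have "f w = u \<or> f w = v"
          using f[OF \<open>card (nbrs E w) = 2\<close>] w by simp
        ultimately show ?thesis
          by (auto simp: \<phi>_def insert_commute)
      qed
    qed
    with E(4) show False ..
  qed
  then obtain u where u: "u \<in> V" "card {v \<in> V. S u v} < 3"
    using min_degree_3_K4_minor[OF \<open>finite V\<close> \<open>V \<noteq> {}\<close> \<open>symp S\<close> \<open>irreflp S\<close>] not_le by blast
  \<comment> \<open>Every edge at \<open>u\<close> leads to a neighbour in the suppressed graph: to
    \<open>x\<close> itself if \<open>x\<close> has degree 3, otherwise through \<open>x\<close> to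
    its other neighbour, which has degree 3 since the degree sum is at least 5.\<close>
  have "\<exists>v. S u v \<and> (v = x \<or> nbrs E x = {u, v})" if x: "x \<in> nbrs E u" for x
  proof (cases "card (nbrs E x) = 3")
    case True
    then have "S u x"
      using x u(1) self_notin_nbrs[OF E(2)] by (auto simp: S_def V_def nbrs_def)
    then show ?thesis by blast
  next
    case False
    have "{u, x} \<in> E" using x by (simp add: nbrs_def)
    then have "card (nbrs E x) = 2"
      using heavy[rule_format, of u x] E(3)[of u] E(3)[of x] False by linarith
    moreover have "u \<in> nbrs E x" using x nbrs_sym by metis
    ultimately obtain v where v: "nbrs E x = {u, v}" "u \<noteq> v"
      by (metis card_2_iff doubleton_eq_iff insertE singletonD)
    then have "{x, v} \<in> E" by (auto simp: nbrs_def)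
    then have "card (nbrs E v) = 3"
      using heavy[rule_format, of x v] E(3)[of v] \<open>card (nbrs E x) = 2\<close> by linarith
    then have "S u v"
      using v u(1) by (auto simp: S_def V_def)
    then show ?thesis using v by blast
  qed
  then obtain g where g: "\<And>x. x \<in> nbrs E u \<Longrightarrow> S u (g x) \<and> (g x = x \<or> nbrs E x = {u, g x})"
    by metis
  have "g ` nbrs E u \<subseteq> {v \<in> V. S u v}"
    using g by (auto simp: S_def)
  \<comment> \<open>Three edges leave \<open>u\<close> but it has fewer than three neighbours under
    \<open>S\<close>, so two of the edges lead to the same one.\<close>
  then have "card (g ` nbrs E u) < card (nbrs E u)"
    using u \<open>finite V\<close> card_mono[of "{v \<in> V. S u v}" "g ` nbrs E u"] by (simp add: V_def)
  then have "\<not> inj_on g (nbrs E u)"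
    by (rule pigeonhole)
  then obtain x x' where x: "x \<in> nbrs E u" "x' \<in> nbrs E u" "x \<noteq> x'" "g x = g x'"
    by (auto simp: inj_on_def)
  define v where "v = g x"
  have v: "v = x \<or> nbrs E x = {u, v}" "v = x' \<or> nbrs E x' = {u, v}" "S u v"
    using g[OF x(1)] g[OF x(2)] x(4) by (auto simp: v_def)
  then have "u \<noteq> v" "card (nbrs E u) = 3" "card (nbrs E v) = 3"
    by (auto simp: S_def V_def)
  consider "nbrs E x = {u, v}" "nbrs E x' = {u, v}" | "v = x" "nbrs E x' = {u, v}" | "v = x'" "nbrs E x = {u, v}"
    using v(1,2) x(3) by blast
  then show ?thesis
  proof cases
    case 1
    then show ?thesis using that(1) \<open>u \<noteq> v\<close> x(3) by blast
  next
    case 2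
    then have "{u, v} \<in> E" using x(1) by (simp add: nbrs_def)
    then show ?thesis using that(2) 2 \<open>card (nbrs E u) = 3\<close> \<open>card (nbrs E v) = 3\<close> by blast
  next
    case 3
    then have "{u, v} \<in> E" using x(2) by (simp add: nbrs_def)
    then show ?thesis using that(2) 3 \<open>card (nbrs E u) = 3\<close> \<open>card (nbrs E v) = 3\<close> by blast
  qed
qed

text \<open>A vertex that keeps at most one edge forbids at most one colour \<open>a\<close> to the
  edges put back at it. Without any edge, an arbitrary value of \<open>a\<close> serves.\<close>

lemma single_colour:
  assumes E: "finite E" "\<forall>e\<in>E. card e = 2" and c: "edge_3_colouring E c" and "card (nbrs E x) \<le> 1"
  shows "\<exists>a<3. \<forall>e\<in>E. x \<in> e \<longrightarrow> c e = a"
proof (cases "nbrs E x = {}")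
  case True
  then have "\<forall>e\<in>E. x \<notin> e" using edge_eq[OF E(2), of _ x] by blast
  then show ?thesis by (intro exI[of _ 0]) simp
next
  case False
  then obtain y where y: "nbrs E x = {y}"
    using assms(4) finite_nbrs[OF E, of x] by (metis card_0_eq card_1_singletonE le_neq_implies_less less_one)
  then have "{x, y} \<in> E" by (auto simp: nbrs_def)
  then have "c {x, y} < 3" using c by (auto simp: edge_3_colouring_def)
  moreover have "e = {x, y}" if "e \<in> E" "x \<in> e" for e
    using edge_eq[OF E(2) that] y by auto
  ultimately show ?thesis by blast
qed

lemma card_nbrs_diff:
  assumes E: "finite E" "\<forall>e\<in>E. card e = 2" "card (nbrs E x) \<le> 3"
    and F: "F \<subseteq> E" "nbrs F x \<subseteq> nbrs E x - {y, z}" "y \<noteq> z" "y \<in> nbrs E x" "z \<in> nbrs E x"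
  shows "card (nbrs F x) \<le> 1"
proof -
  have "card (nbrs F x) \<le> card (nbrs E x - {y, z})"
    using F(2) finite_nbrs[OF E(1,2)] by (intro card_mono) auto
  also have "\<dots> = card (nbrs E x) - 2"
    using F(3-5) by (subst card_Diff_subset) auto
  finally show ?thesis using E(3) by simp
qed

section \<open>Undoing the removal of a 4-cycle and the removal or contraction of a triangle\<close>

lemma two_other_colours: "\<exists>p q::nat. p < 3 \<and> q < 3 \<and> p \<noteq> q \<and> p \<noteq> a \<and> q \<noteq> a"
proof -
  consider "a \<noteq> 0" "a \<noteq> 1" | "a \<noteq> 0" "a \<noteq> 2" | "a \<noteq> 1" "a \<noteq> 2"
    by linarith
  then show ?thesis
    by cases (rule exI[of _ 0], rule exI[of _ 1], simp, rule exI[of _ 0], rule exI[of _ 2], simp,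
      rule exI[of _ 1], rule exI[of _ 2], simp)
qed

text \<open>After the removal \<open>w\<close> and \<open>w'\<close> have no edge left, while
  \<open>u\<close> and \<open>v\<close> keep at most one each. So each edge of the cycle may choose
  between two colours, and even cycles can be coloured from lists of size two.\<close>

lemma extend_4_cycle:
  assumes good: "subcubic_K4_free E" and ne: "u \<noteq> v" "w \<noteq> w'"
    and w: "nbrs E w = {u, v}" "nbrs E w' = {u, v}"
    and c: "edge_3_colouring (E - {{u, w}, {u, w'}, {v, w}, {v, w'}}) c"
  shows "\<exists>c. edge_3_colouring E c"
proof -
  define F where "F = {{u, w}, {u, w'}, {v, w}, {v, w'}}"
  have E: "finite E" "\<forall>e\<in>E. card e = 2" "\<And>x. card (nbrs E x) \<le> 3"
    using good by (auto simp: subcubic_K4_free_def)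
  have FE: "F \<subseteq> E"
    using w by (auto simp: F_def nbrs_def insert_commute)
  have E': "finite (E - F)" "\<forall>e\<in>E - F. card e = 2"
    using E by auto
  have dist: "w \<noteq> u" "w \<noteq> v" "w' \<noteq> u" "w' \<noteq> v"
    using w self_notin_nbrs[OF E(2)] by blast+
  have mem: "w \<in> nbrs E u" "w' \<in> nbrs E u" "w \<in> nbrs E v" "w' \<in> nbrs E v"
    using w nbrs_sym[of _ E] by auto
  have "nbrs (E - F) u \<subseteq> nbrs E u - {w, w'}" "nbrs (E - F) v \<subseteq> nbrs E v - {w, w'}"
    by (auto simp: nbrs_def F_def)
  then have "card (nbrs (E - F) u) \<le> 1" "card (nbrs (E - F) v) \<le> 1"
    using card_nbrs_diff[OF E Diff_subset _ ne(2)] mem by blast+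
  then obtain a b where a: "a < 3" "\<forall>e\<in>E - F. u \<in> e \<longrightarrow> c e = a" and b: "b < 3" "\<forall>e\<in>E - F. v \<in> e \<longrightarrow> c e = b"
    using single_colour[OF E' c[folded F_def]] by metis
  have "z \<notin> e" if "e \<in> E - F" "z \<in> {w, w'}" for e z
    by (rule notin_edge[OF E(2) that(1)]) (use that(2) w in \<open>auto simp: F_def doubleton_eq_iff\<close>)
  then have off: "w \<notin> e" "w' \<notin> e" if "e \<in> E - F" for e
    using that by simp_all
  obtain p q r s :: nat where pq: "p < 3" "q < 3" "r < 3" "s < 3" "p \<noteq> q" "r \<noteq> s" "p \<noteq> r" "q \<noteq> s"
    "p \<noteq> a" "q \<noteq> a" "r \<noteq> b" "s \<noteq> b"
  proof -
    obtain p q :: nat where pq: "p < 3" "q < 3" "p \<noteq> q" "p \<noteq> a" "q \<noteq> a"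
      using two_other_colours[of a] by blast
    obtain r s :: nat where rs: "r < 3" "s < 3" "r \<noteq> s" "r \<noteq> b" "s \<noteq> b"
      using two_other_colours[of b] by blast
    \<comment> \<open>One of the two orders of \<open>r\<close> and \<open>s\<close> works: if
      \<open>p = r\<close> or \<open>q = s\<close>, then exchanging them gives
      \<open>p \<noteq> s\<close> and \<open>q \<noteq> r\<close>.\<close>
    show thesis
      using that[of p q r s] that[of p q s r] pq rs by metis
  qed
  define d where "d e = (if e = {u, w} then p else if e = {u, w'} then q else if e = {v, w} then r else s)" for e
  have d: "d {u, w} = p" "d {u, w'} = q" "d {v, w} = r" "d {v, w'} = s"
    using dist ne by (auto simp: d_def doubleton_eq_iff)
  have "edge_3_colouring F d"
    unfolding edge_3_colouring_def F_def using pq dist ne by (simp add: d)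
  moreover have "c e \<noteq> d f" if "e \<in> E - F" "f \<in> F" "x \<in> e" "x \<in> f" for e f x
  proof -
    have ce: "u \<in> e \<Longrightarrow> c e = a" "v \<in> e \<Longrightarrow> c e = b"
      using a(2) b(2) that(1) by blast+
    have x: "x \<noteq> w" "x \<noteq> w'"
      using off[OF that(1)] that(3) by blast+
    consider "f = {u, w}" | "f = {u, w'}" | "f = {v, w}" | "f = {v, w'}"
      using \<open>f \<in> F\<close> unfolding F_def by blast
    then show ?thesis
      by cases (use ce x that(3,4) pq d in auto)
  qed
  ultimately have "\<exists>c. edge_3_colouring (E - F \<union> F) c"
    by (intro edge_3_colouring_Un[OF c[folded F_def]]) auto
  then show ?thesis
    using FE by (simp add: Un_absorb2)
qed

text \<open>The case where contraction would merge \<open>ux\<close> and \<open>vx\<close>. The five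
  edges on \<open>u\<close>, \<open>v\<close>, \<open>w\<close>, \<open>x\<close> are deleted, and
  the rest of the graph can touch them only in \<open>x\<close>.\<close>

lemma extend_triangle_pendant:
  assumes good: "subcubic_K4_free E" and ne: "distinct [u, v, w, x]"
    and nb: "nbrs E w = {u, v}" "nbrs E u = {v, w, x}" "nbrs E v = {u, w, x}"
    and c: "edge_3_colouring (E - {{u, x}, {v, x}, {u, v}, {u, w}, {v, w}}) c"
  shows "\<exists>c. edge_3_colouring E c"
proof -
  define F where "F = {{u, x}, {v, x}, {u, v}, {u, w}, {v, w}}"
  have E: "finite E" "\<forall>e\<in>E. card e = 2" "\<And>x. card (nbrs E x) \<le> 3"
    using good by (auto simp: subcubic_K4_free_def)
  have FE: "F \<subseteq> E"
    using nb by (auto simp: F_def nbrs_def insert_commute)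
  have E': "finite (E - F)" "\<forall>e\<in>E - F. card e = 2"
    using E by auto
  have "u \<in> nbrs E x" "v \<in> nbrs E x"
    using nb nbrs_sym[of _ E] by auto
  moreover have "nbrs (E - F) x \<subseteq> nbrs E x - {u, v}"
    by (auto simp: nbrs_def F_def insert_commute)
  ultimately have "card (nbrs (E - F) x) \<le> 1"
    using card_nbrs_diff[OF E Diff_subset, of F x u v] ne by auto
  then obtain a where a: "a < 3" "\<forall>e\<in>E - F. x \<in> e \<longrightarrow> c e = a"
    using single_colour[OF E' c[folded F_def]] by metis
  have "z \<notin> e" if "e \<in> E - F" "z \<in> {u, v, w}" for e z
    by (rule notin_edge[OF E(2) that(1)]) (use that(2) nb in \<open>auto simp: F_def doubleton_eq_iff\<close>)
  then have off: "u \<notin> e" "v \<notin> e" "w \<notin> e" if "e \<in> E - F" for e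
    using that by simp_all
  obtain p q :: nat where pq: "p < 3" "q < 3" "p \<noteq> q" "p \<noteq> a" "q \<noteq> a"
    using two_other_colours[of a] by blast
  \<comment> \<open>The colour \<open>a\<close> already present at \<open>x\<close> goes to
    \<open>uv\<close>, the edge of the triangle with both ends of degree 3; the disjoint edges
    \<open>ux\<close> and \<open>vw\<close> share \<open>p\<close>, and \<open>vx\<close> and
    \<open>uw\<close> share \<open>q\<close>.\<close>
  define d where "d e = (if e = {u, v} then a else if e = {u, x} \<or> e = {v, w} then p else q)" for e
  have d: "d {u, x} = p" "d {v, x} = q" "d {u, v} = a" "d {u, w} = q" "d {v, w} = p"
    using ne by (auto simp: d_def doubleton_eq_iff)
  have "edge_3_colouring F d"
    unfolding edge_3_colouring_def F_def using pq a(1) ne by (simp add: d) auto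
  moreover have "c e \<noteq> d f" if "e \<in> E - F" "f \<in> F" "y \<in> e" "y \<in> f" for e f y
  proof -
    have "y \<noteq> u" "y \<noteq> v" "y \<noteq> w"
      using off[OF that(1)] that(3) by blast+
    then have "y = x" "f = {u, x} \<or> f = {v, x}"
      using that(2,4) unfolding F_def by blast+
    moreover have "c e = a"
      using a(2) that(1,3) \<open>y = x\<close> by blast
    ultimately show ?thesis
      using pq d by metis
  qed
  ultimately have "\<exists>c. edge_3_colouring (E - F \<union> F) c"
    by (intro edge_3_colouring_Un[OF c[folded F_def]]) auto
  then show ?thesis
    using FE by (simp add: Un_absorb2)
qed

text \<open>The contracted vertex reuses the name \<open>w\<close>, so no new vertex is needed:
  \<open>w\<close> gives up its edges to \<open>u\<close> and \<open>v\<close> and inherits those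
  that lead from the triangle to \<open>x\<close> and \<open>y\<close>.\<close>

definition contract_triangle :: "'a \<Rightarrow> 'a \<Rightarrow> 'a \<Rightarrow> 'a \<Rightarrow> 'a \<Rightarrow> 'a set set \<Rightarrow> 'a set set" where
  "contract_triangle u v w x y E = E - {{u, x}, {v, y}, {u, v}, {u, w}, {v, w}} \<union> {{x, w}, {y, w}}"

context
  fixes E :: "'a set set" and u v w x y :: 'a
  assumes good: "subcubic_K4_free E" and ne: "distinct [u, v, w, x, y]"
    and nb: "nbrs E w = {u, v}" "nbrs E u = {v, w, x}" "nbrs E v = {u, w, y}"
begin

lemma triangle_off:
  assumes "e \<in> E - {{u, x}, {v, y}, {u, v}, {u, w}, {v, w}}"
  shows "u \<notin> e" "v \<notin> e" "w \<notin> e"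
proof -
  have E: "\<forall>e\<in>E. card e = 2"
    using good by (auto simp: subcubic_K4_free_def)
  have "z \<notin> e" if "z \<in> {u, v, w}" for z
    by (rule notin_edge[OF E assms]) (use that nb in \<open>auto simp: doubleton_eq_iff\<close>)
  then show "u \<notin> e" "v \<notin> e" "w \<notin> e"
    by simp_all
qed

lemma contract_triangle_cases:
  assumes "{s, t} \<in> contract_triangle u v w x y E"
  obtains "{s, t} \<in> E" "s \<notin> {u, v, w}" "t \<notin> {u, v, w}"
    | "s = w" "t = x \<or> t = y" | "t = w" "s = x \<or> s = y"
proof -
  consider "{s, t} \<in> E - {{u, x}, {v, y}, {u, v}, {u, w}, {v, w}}" | "{s, t} = {x, w}" | "{s, t} = {y, w}"
    using assms unfolding contract_triangle_def by blast
  then show thesis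
  proof cases
    case 1
    then have "u \<notin> {s, t}" "v \<notin> {s, t}" "w \<notin> {s, t}"
      by (rule triangle_off)+
    with 1 that(1) show thesis by blast
  next
    case 2
    then show thesis using that(2,3) unfolding doubleton_eq_iff by blast
  next
    case 3
    then show thesis using that(2,3) unfolding doubleton_eq_iff by blast
  qed
qed

text \<open>No degree exceeds 3, as \<open>w\<close> ends with at most two neighbours while
  \<open>x\<close> and \<open>y\<close> exchange one neighbour for \<open>w\<close>. A K4 minor
  would lift by expanding \<open>w\<close> to the triangle.\<close>

lemma contract_triangle_good: "subcubic_K4_free (contract_triangle u v w x y E)"
proof -
  let ?E' = "contract_triangle u v w x y E"
  have E: "finite E" "\<forall>e\<in>E. card e = 2" "\<And>x. card (nbrs E x) \<le> 3" "\<not> K4_minor (\<Union>E) (adjacent E)"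
    using good by (auto simp: subcubic_K4_free_def)
  have mem: "{u, x} \<in> E" "{v, y} \<in> E" "{u, w} \<in> E" "{v, w} \<in> E" "{u, v} \<in> E"
    using nb by (auto simp: nbrs_def insert_commute)
  have E': "finite ?E'" "\<forall>e\<in>?E'. card e = 2"
    using E ne by (auto simp: contract_triangle_def)
  have swap: "card (nbrs ?E' s) \<le> card (nbrs E s)" if "nbrs ?E' s \<subseteq> insert w (nbrs E s - {t})" "t \<in> nbrs E s" for s t
  proof -
    have "card (nbrs ?E' s) \<le> card (insert w (nbrs E s - {t}))"
      using that(1) finite_nbrs[OF E(1,2)] by (intro card_mono) auto
    also have "\<dots> \<le> Suc (card (nbrs E s - {t}))"
      by (rule card_insert_le_m1) auto
    also have "\<dots> = card (nbrs E s)"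
      using that(2) finite_nbrs[OF E(1,2)] by (metis card_Suc_Diff1)
    finally show ?thesis .
  qed
  have "card (nbrs ?E' s) \<le> 3" for s
  proof -
    consider "s = w" | "s = x" | "s = y" | "s \<notin> {w, x, y}" by blast
    then show ?thesis
    proof cases
      case 1
      have "nbrs ?E' w \<subseteq> {x, y}"
        using ne by (auto simp: nbrs_def elim: contract_triangle_cases)
      then have "card (nbrs ?E' w) \<le> card {x, y}"
        by (intro card_mono) auto
      also have "\<dots> \<le> 3" by (simp add: card_insert_if)
      finally show ?thesis using 1 by simp
    next
      case 2
      have "nbrs ?E' x \<subseteq> insert w (nbrs E x - {u})" "u \<in> nbrs E x"
        using ne mem by (auto simp: nbrs_def insert_commute elim: contract_triangle_cases)
      then show ?thesis using swap E(3) le_trans 2 by blast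
    next
      case 3
      have "nbrs ?E' y \<subseteq> insert w (nbrs E y - {v})" "v \<in> nbrs E y"
        using ne mem by (auto simp: nbrs_def insert_commute elim: contract_triangle_cases)
      then show ?thesis using swap E(3) le_trans 3 by blast
    next
      case 4
      then have "nbrs ?E' s \<subseteq> nbrs E s"
        by (auto simp: nbrs_def elim: contract_triangle_cases)
      then have "card (nbrs ?E' s) \<le> card (nbrs E s)"
        using finite_nbrs[OF E(1,2)] by (intro card_mono)
      then show ?thesis using E(3) le_trans by blast
    qed
  qed
  moreover have "\<not> K4_minor (\<Union>?E') (adjacent ?E')"
  proof
    assume minor: "K4_minor (\<Union>?E') (adjacent ?E')"
    have "u \<notin> e \<and> v \<notin> e" if "e \<in> ?E'" for e
    proof -
      consider "e \<in> E - {{u, x}, {v, y}, {u, v}, {u, w}, {v, w}}" | "e = {x, w}" | "e = {y, w}"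
        using \<open>e \<in> ?E'\<close> unfolding contract_triangle_def by blast
      then show ?thesis
      proof cases
        case 1
        then show ?thesis using triangle_off by blast
      qed (use ne in auto)
    qed
    then have V: "u \<notin> \<Union>?E'" "v \<notin> \<Union>?E'"
      by blast+
    have UE: "u \<in> \<Union>E" "v \<in> \<Union>E" "w \<in> \<Union>E" "x \<in> \<Union>E" "y \<in> \<Union>E"
      using mem by blast+
    then have sub: "\<Union>?E' \<subseteq> \<Union>E"
      unfolding contract_triangle_def by blast
    define \<phi> where "\<phi> s = (if s = w then {u, v, w} else {s})" for s
    have "K4_minor (\<Union>E) (adjacent E)"
    proof (rule K4_minor_model[OF minor, where \<phi> = \<phi>])
      fix s assume s: "s \<in> \<Union>?E'"
      have "connected_in (adjacent E) {u, v, w}"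
        by (rule connected_in_star[OF symp_adjacent, of w]) (use mem in \<open>auto simp: insert_commute\<close>)
      then have "connected_in (adjacent E) (\<phi> s)"
        by (simp add: \<phi>_def connected_in_singleton)
      moreover have "\<phi> s \<subseteq> \<Union>E"
        using s sub UE by (auto simp: \<phi>_def simp del: Union_iff)
      ultimately show "connected_in (adjacent E) (\<phi> s) \<and> \<phi> s \<subseteq> \<Union>E" ..
      fix t assume t: "t \<in> \<Union>?E'"
      have "s \<noteq> u" "s \<noteq> v" "t \<noteq> u" "t \<noteq> v"
        using s t V by blast+
      then show "\<phi> s \<inter> \<phi> t = {}" if "s \<noteq> t"
        using that by (auto simp: \<phi>_def)
      assume "{s, t} \<in> ?E'"
      then show "\<exists>a\<in>\<phi> s. \<exists>b\<in>\<phi> t. {a, b} \<in> E"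
      proof (cases rule: contract_triangle_cases)
        case 1
        then show ?thesis by (auto simp: \<phi>_def)
      next
        case 2
        then show ?thesis using ne mem by (auto simp: \<phi>_def)
      next
        case 3
        then show ?thesis using ne mem by (auto simp: \<phi>_def insert_commute)
      qed
    qed
    with E(4) show False ..
  qed
  ultimately show ?thesis
    using E' by (simp add: subcubic_K4_free_def)
qed

lemma card_contract_triangle: "card (contract_triangle u v w x y E) < card E"
proof -
  let ?F = "{{u, x}, {v, y}, {u, v}, {u, w}, {v, w}}"
  have "finite E" using good by (simp add: subcubic_K4_free_def)
  have F: "?F \<subseteq> E"
    using nb by (auto simp: nbrs_def insert_commute)
  have "card ?F = 5"
    using ne by (auto simp: card_insert_if doubleton_eq_iff)
  then have "card (E - ?F) + 5 = card E"
    using card_Diff_subset[OF _ F] card_mono[OF \<open>finite E\<close> F] by simp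
  moreover have "card (contract_triangle u v w x y E) \<le> card (E - ?F) + card {{x, w}, {y, w}}"
    unfolding contract_triangle_def by (rule card_Un_le)
  moreover have "card {{x, w}, {y, w}} \<le> 2"
    by (simp add: card_insert_if)
  ultimately show ?thesis by linarith
qed

text \<open>The colours \<open>a\<close> of \<open>xw\<close> and \<open>b\<close> of
  \<open>yw\<close> differ, as these edges meet in \<open>w\<close>. They pass to \<open>ux\<close>
  and \<open>vy\<close>. Then the side opposite to \<open>u\<close> repeats \<open>a\<close>, the
  side opposite to \<open>v\<close> repeats \<open>b\<close>, and \<open>uv\<close> gets the third
  colour.\<close>

lemma extend_contract_triangle:
  assumes c: "edge_3_colouring (contract_triangle u v w x y E) c"
  shows "\<exists>c. edge_3_colouring E c"
proof -
  define F where "F = {{u, x}, {v, y}, {u, v}, {u, w}, {v, w}}"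
  have FE: "F \<subseteq> E"
    using nb by (auto simp: F_def nbrs_def insert_commute)
  have E': "contract_triangle u v w x y E = E - F \<union> {{x, w}, {y, w}}"
    by (simp add: contract_triangle_def F_def)
  have off: "u \<notin> e" "v \<notin> e" "w \<notin> e" if "e \<in> E - F" for e
    using triangle_off[of e] that by (auto simp: F_def)
  define a b where "a = c {x, w}" and "b = c {y, w}"
  have ab: "a < 3" "b < 3" "a \<noteq> b"
    using c ne by (auto simp: a_def b_def edge_3_colouring_def E' doubleton_eq_iff)
  have ca: "c e \<noteq> a" if "e \<in> E - F" "x \<in> e" for e
  proof -
    have "e \<noteq> {x, w}" using off(3)[OF that(1)] by auto
    then show ?thesis
      using c that by (auto simp: a_def edge_3_colouring_def E')
  qed
  have cb: "c e \<noteq> b" if "e \<in> E - F" "y \<in> e" for e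
  proof -
    have "e \<noteq> {y, w}" using off(3)[OF that(1)] by auto
    then show ?thesis
      using c that by (auto simp: b_def edge_3_colouring_def E')
  qed
  have c0: "edge_3_colouring (E - F) c"
    using c by (auto simp: edge_3_colouring_def E')
  \<comment> \<open>The colours 0, 1, 2 add up to 3, so \<open>3 - a - b\<close> is the one
    different from \<open>a\<close> and \<open>b\<close>.\<close>
  define d where "d e = (if e = {u, v} then 3 - a - b else if e = {u, x} \<or> e = {v, w} then a else b)" for e
  have d: "d {u, x} = a" "d {v, y} = b" "d {u, v} = 3 - a - b" "d {u, w} = b" "d {v, w} = a"
    using ne by (auto simp: d_def doubleton_eq_iff)
  have third: "3 - a - b < 3" "3 - a - b \<noteq> a" "3 - a - b \<noteq> b"
    using ab by presburger+
  have "edge_3_colouring F d"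
    unfolding edge_3_colouring_def F_def using ab third ne by (simp add: d) auto
  moreover have "c e \<noteq> d f" if "e \<in> E - F" "f \<in> F" "z \<in> e" "z \<in> f" for e f z
  proof -
    have "z \<noteq> u" "z \<noteq> v" "z \<noteq> w"
      using off[OF that(1)] that(3) by blast+
    then have "z = x \<and> f = {u, x} \<or> z = y \<and> f = {v, y}"
      using that(2,4) unfolding F_def by blast
    then show ?thesis
      using ca[OF that(1)] cb[OF that(1)] that(3) d by metis
  qed
  ultimately have "\<exists>c. edge_3_colouring (E - F \<union> F) c"
    by (intro edge_3_colouring_Un[OF c0]) auto
  then show ?thesis
    using FE by (simp add: Un_absorb2)
qed

end

text \<open>A degree bound alone would not do: K4 with one edge subdivided is subcubic, but three
  matchings on its five vertices cover at most six of its seven edges.\<close>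

theorem subcubic_K4_free_edge_3_colouring:
  "subcubic_K4_free E \<Longrightarrow> \<exists>c. edge_3_colouring E c"
proof (induction "card E" arbitrary: E rule: less_induct)
  case less
  note good = \<open>subcubic_K4_free E\<close>
  have E: "finite E" "\<forall>e\<in>E. card e = 2" "\<And>x. card (nbrs E x) \<le> 3"
    using good by (auto simp: subcubic_K4_free_def)
  have sub: "\<exists>c. edge_3_colouring (E - F) c" if "e \<in> E" "e \<in> F" for e F
  proof (rule less.hyps)
    show "card (E - F) < card E"
      using that E(1) by (intro psubset_card_mono) auto
    show "subcubic_K4_free (E - F)"
      using good by (rule subcubic_K4_free_subset) blast
  qed
  show ?case
  proof (cases "\<exists>u v. {u, v} \<in> E \<and> card (nbrs E u) + card (nbrs E v) \<le> 4")
    case True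
    then obtain u v where uv: "{u, v} \<in> E" "card (nbrs E u) + card (nbrs E v) \<le> 4"
      by blast
    then show ?thesis
      using sub[of "{u, v}" "{{u, v}}"] extend_light_edge[OF E(1,2) uv] by blast
  next
    case False
    have heavy: "\<forall>u v. {u, v} \<in> E \<longrightarrow> 5 \<le> card (nbrs E u) + card (nbrs E v)"
    proof (intro allI impI)
      fix u v assume "{u, v} \<in> E"
      then have "\<not> card (nbrs E u) + card (nbrs E v) \<le> 4"
        using \<open>\<nexists>u v. {u, v} \<in> E \<and> card (nbrs E u) + card (nbrs E v) \<le> 4\<close> by blast
      then show "5 \<le> card (nbrs E u) + card (nbrs E v)" by simp
    qed
    show ?thesis
    proof (cases "E = {}")
      case True
      then have "edge_3_colouring E (\<lambda>_. 0)" by (simp add: edge_3_colouring_def)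
      then show ?thesis by blast
    next
      case False
      show ?thesis
      proof (rule reducible_configuration[OF good False heavy])
        fix u v w w' assume 1: "u \<noteq> v" "w \<noteq> w'" "nbrs E w = {u, v}" "nbrs E w' = {u, v}"
        then have "{u, w} \<in> E" by (auto simp: nbrs_def insert_commute)
        then show ?thesis
          using sub[of "{u, w}" "{{u, w}, {u, w'}, {v, w}, {v, w'}}"] extend_4_cycle[OF good 1] by blast
      next
        fix u v w assume 2: "{u, v} \<in> E" "nbrs E w = {u, v}" "card (nbrs E u) = 3" "card (nbrs E v) = 3"
        \<comment> \<open>The two corners of degree 3 play the same role, so the neighbour outside
          the triangle is found for both by one argument.\<close>
        have third: "\<exists>x. nbrs E s = {t, w, x} \<and> distinct [s, t, w, x]"
          if "{s, t} \<in> E" "nbrs E w = {s, t}" "card (nbrs E s) = 3" for s t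
        proof -
          have self: "w \<notin> nbrs E w" "s \<notin> nbrs E s"
            using self_notin_nbrs[OF E(2)] by blast+
          have mem: "t \<in> nbrs E s"
            using that(1) by (simp add: nbrs_def)
          have "s \<in> nbrs E w"
            using that(2) by simp
          then have "w \<in> nbrs E s"
            using nbrs_sym[of w E s] by simp
          then have st: "s \<noteq> t" "w \<noteq> s" "w \<noteq> t" "t \<in> nbrs E s" "w \<in> nbrs E s" "s \<notin> nbrs E s"
            using self mem that(2) by auto
          then have "card (nbrs E s - {t, w}) = 1"
            using that(3) finite_nbrs[OF E(1,2)] by (subst card_Diff_subset) auto
          then obtain x where "nbrs E s - {t, w} = {x}"
            by (auto simp: card_1_singleton_iff)
          then have "nbrs E s = {t, w, x}" "x \<noteq> t" "x \<noteq> w" "x \<noteq> s"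
            using st by auto
          then show ?thesis using st by auto
        qed
        obtain x where x: "nbrs E u = {v, w, x}" "distinct [u, v, w, x]"
          using third[of u v] 2 by blast
        obtain y where y: "nbrs E v = {u, w, y}" "distinct [v, u, w, y]"
          using third[of v u] 2 by (auto simp: insert_commute)
        show ?thesis
        proof (cases "x = y")
          case True
          then show ?thesis
            using sub[OF 2(1), of "{{u, x}, {v, x}, {u, v}, {u, w}, {v, w}}"]
              extend_triangle_pendant[OF good x(2) 2(2) x(1)] y(1) by blast
        next
          case False
          then have ne: "distinct [u, v, w, x, y]"
            using x y by auto
          note conf = good ne 2(2) x(1) y(1)
          show ?thesis
            using less.hyps[OF card_contract_triangle[OF conf] contract_triangle_good[OF conf]]
              extend_contract_triangle[OF conf] by blast
        qed
      qed
    qed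
  qed
qed

section \<open>Drawings of the complete graph on four vertices\<close>

lemma on_not_inside: "x \<in> S \<Longrightarrow> x \<notin> inside S"
  by (simp add: inside_def)

text \<open>Off the closed set \<open>S\<close> the plane is the disjoint union of the open sets
  \<open>inside S\<close> and \<open>outside S\<close>, and a connected set cannot meet
  both.\<close>

lemma connected_subset_inside:
  fixes S :: "complex set"
  assumes "closed S" "connected A" "A \<inter> S = {}" "A \<inter> inside S \<noteq> {}"
  shows "A \<subseteq> inside S"
proof -
  have "A \<subseteq> inside S \<union> outside S"
    using assms(3) by (auto simp: inside_Un_outside)
  moreover have "inside S \<inter> outside S \<inter> A = {}"
    using inside_Int_outside by auto
  ultimately have "outside S \<inter> A = {}"
    using connectedD[OF assms(2) open_inside[OF assms(1)] open_outside[OF assms(1)]] assms(4) by blast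
  with \<open>A \<subseteq> inside S \<union> outside S\<close> show ?thesis
    by blast
qed

lemma connected_arc_minus_start:
  fixes g :: "real \<Rightarrow> complex"
  assumes "arc g"
  shows "connected (path_image g - {pathstart g})"
proof -
  have "path_image g - {pathstart g} = g ` {0<..1}"
  proof -
    have "inj_on g {0..1}" using assms by (simp add: arc_def)
    moreover have "{0<..1} = {0..1} - {0::real}" by auto
    ultimately have "g ` {0<..1} = g ` {0..1} - g ` {0}"
      by (simp add: inj_on_image_set_diff)
    then show ?thesis by (simp add: path_image_def pathstart_def)
  qed
  moreover have "continuous_on {0<..1} g"
    using assms unfolding arc_def path_def by (auto intro: continuous_on_subset)
  ultimately show ?thesis
    by (simp add: connected_continuous_image)
qed

text \<open>Arcs are given in both directions, tied by \<open>rev_arc\<close>, so that triangles can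
  be oriented and a side shared by two of them can cancel. In \<open>meet\<close>, opposite sides
  have disjoint index sets and hence disjoint images.\<close>

locale K4_arcs =
  fixes a :: "nat \<Rightarrow> complex" and g :: "nat \<Rightarrow> nat \<Rightarrow> real \<Rightarrow> complex"
  assumes arcs: "i < 4 \<Longrightarrow> j < 4 \<Longrightarrow> i \<noteq> j \<Longrightarrow>
      arc (g i j) \<and> pathstart (g i j) = a i \<and> pathfinish (g i j) = a j"
    and rev_arc: "i \<noteq> j \<Longrightarrow> g j i = reversepath (g i j)"
    and meet: "i < 4 \<Longrightarrow> j < 4 \<Longrightarrow> k < 4 \<Longrightarrow> l < 4 \<Longrightarrow> i \<noteq> j \<Longrightarrow> k \<noteq> l \<Longrightarrow> {i, j} \<noteq> {k, l} \<Longrightarrow>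
      path_image (g i j) \<inter> path_image (g k l) \<subseteq> a ` ({i, j} \<inter> {k, l})"
begin

definition tri :: "nat \<Rightarrow> nat \<Rightarrow> nat \<Rightarrow> complex set" where
  "tri i j k = path_image (g i j) \<union> path_image (g j k) \<union> path_image (g k i)"

definition loop :: "nat \<Rightarrow> nat \<Rightarrow> nat \<Rightarrow> real \<Rightarrow> complex" where
  "loop i j k = g i j +++ g j k +++ g k i"

text \<open>The last index stands for the vertex opposite to the triangle
  \<open>i j k\<close>.\<close>

definition distinct4 :: "nat \<Rightarrow> nat \<Rightarrow> nat \<Rightarrow> nat \<Rightarrow> bool" where
  "distinct4 i j k l \<longleftrightarrow> i < 4 \<and> j < 4 \<and> k < 4 \<and> l < 4 \<and> distinct [i, j, k, l]"

lemma tri_rotate: "tri i j k = tri j k i"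
  by (auto simp: tri_def)

lemma image_sym: "path_image (g j i) = path_image (g i j)"
  by (cases "i = j") (simp_all add: rev_arc[of i j])

lemma path_image_loop:
  assumes "distinct4 i j k l"
  shows "path_image (loop i j k) = tri i j k"
  using assms arcs by (auto simp: loop_def tri_def distinct4_def path_image_join)

lemma simple_loop:
  assumes "distinct4 i j k l"
  shows "simple_path (loop i j k)"
  unfolding loop_def
proof (rule simple_path_join_loop)
  have lt: "i < 4" "j < 4" "k < 4" "i \<noteq> j" "j \<noteq> k" "k \<noteq> i"
    using assms by (auto simp: distinct4_def)
  note A = arcs[of i j] arcs[of j k] arcs[of k i]
  have I: "path_image (g i j) \<inter> path_image (g j k) \<subseteq> {a j}"
    "path_image (g j k) \<inter> path_image (g k i) \<subseteq> {a k}"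
    "path_image (g i j) \<inter> path_image (g k i) \<subseteq> {a i}"
    using lt meet[of i j j k] meet[of j k k i] meet[of i j k i] by (auto simp: doubleton_eq_iff)
  show "arc (g i j)"
    using lt A by simp
  show "arc (g j k +++ g k i)"
    by (rule arc_join) (use lt A I in auto)
  show "pathfinish (g i j) = pathstart (g j k +++ g k i)" "pathfinish (g j k +++ g k i) = pathstart (g i j)"
    using lt A by auto
  have "path_image (g j k +++ g k i) = path_image (g j k) \<union> path_image (g k i)"
    using lt A by (simp add: path_image_join)
  then show "path_image (g i j) \<inter> path_image (g j k +++ g k i) \<subseteq>
      {pathstart (g i j), pathstart (g j k +++ g k i)}"
    using lt A I by auto
qed

lemma closed_tri: "distinct4 i j k l \<Longrightarrow> closed (tri i j k)"
  using simple_loop path_image_loop by (metis closed_simple_path_image)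

text \<open>The Jordan curve theorem. By the frontier equation the inside determines the triangle,
  which is how two insides are told apart.\<close>

lemma tri_Jordan:
  assumes "distinct4 i j k l"
  shows "inside (tri i j k) \<noteq> {}" "connected (inside (tri i j k))" "frontier (inside (tri i j k)) = tri i j k"
proof -
  have "pathfinish (loop i j k) = pathstart (loop i j k)"
    using assms arcs by (auto simp: loop_def distinct4_def)
  from Jordan_inside_outside[OF simple_loop[OF assms] this]
  show "inside (tri i j k) \<noteq> {}" "connected (inside (tri i j k))" "frontier (inside (tri i j k)) = tri i j k"
    by (auto simp: path_image_loop[OF assms])
qed

text \<open>The winding number is 1 or -1 inside a simple closed curve and 0 outside. The sign
  depends on the unknown orientation, so only vanishing is recorded.\<close>

lemma winding_loop:
  assumes "distinct4 i j k l" "z \<notin> tri i j k"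
  shows "winding_number (loop i j k) z = winding_number (g i j) z + winding_number (g j k) z + winding_number (g k i) z"
    and "winding_number (loop i j k) z = 0 \<longleftrightarrow> z \<notin> inside (tri i j k)"
proof -
  have lt: "i < 4" "j < 4" "k < 4" "i \<noteq> j" "j \<noteq> k" "k \<noteq> i"
    using assms by (auto simp: distinct4_def)
  note A = arcs[of i j] arcs[of j k] arcs[of k i]
  have P: "path (g i j)" "path (g j k)" "path (g k i)"
    using A lt by (auto intro: arc_imp_path)
  show "winding_number (loop i j k) z = winding_number (g i j) z + winding_number (g j k) z + winding_number (g k i) z"
    unfolding loop_def using assms(2) A lt P
    by (simp add: winding_number_join path_image_join tri_def)
  have closed_loop: "pathfinish (loop i j k) = pathstart (loop i j k)"
    using A lt by (auto simp: loop_def)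
  have S: "simple_path (loop i j k)" "path_image (loop i j k) = tri i j k"
    using simple_loop[OF assms(1)] path_image_loop[OF assms(1)] by auto
  show "winding_number (loop i j k) z = 0 \<longleftrightarrow> z \<notin> inside (tri i j k)"
  proof
    assume "z \<notin> inside (tri i j k)"
    then have "z \<in> outside (tri i j k)"
      using assms(2) inside_Un_outside[of "tri i j k"] by blast
    then show "winding_number (loop i j k) z = 0"
      using S closed_loop simple_path_imp_path by (intro winding_number_zero_in_outside) auto
  next
    assume "winding_number (loop i j k) z = 0"
    then show "z \<notin> inside (tri i j k)"
      using simple_closed_path_winding_number_inside[OF S(1)] S(2) by (metis zero_neq_neg_one zero_neq_one)
  qed
qed

end

text \<open>All that is kept of outerplanarity: no triangle encloses the fourth vertex.\<close>

locale outer_K4_arcs = K4_arcs +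
  assumes outer: "distinct4 i j k l \<Longrightarrow> a l \<notin> inside (tri i j k)"
begin

text \<open>Without its start \<open>a i\<close> the spoke is still connected, avoids the triangle,
  and contains \<open>a l\<close>, which is not inside; so none of it is.\<close>

lemma spoke_not_inside:
  assumes d: "distinct4 i j k l"
  shows "path_image (g i l) \<inter> inside (tri i j k) = {}"
proof -
  let ?S = "path_image (g i l) - {a i}"
  have lt: "i < 4" "j < 4" "k < 4" "l < 4" "i \<noteq> j" "j \<noteq> k" "k \<noteq> i" "i \<noteq> l" "j \<noteq> l" "k \<noteq> l"
    using d by (auto simp: distinct4_def)
  have A: "arc (g i l)" "pathstart (g i l) = a i" "pathfinish (g i l) = a l"
    using arcs[of i l] lt by auto
  have "a l \<noteq> a i"
    using A by (metis arc_distinct_ends)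
  then have "a l \<in> ?S"
    using A(3) by (metis Diff_iff empty_iff insert_iff pathfinish_in_path_image)
  have "path_image (g i l) \<inter> path_image (g i j) \<subseteq> {a i}" "path_image (g i l) \<inter> path_image (g j k) \<subseteq> {}"
    "path_image (g i l) \<inter> path_image (g k i) \<subseteq> {a i}"
    using meet[of i l i j] meet[of i l j k] meet[of i l k i] lt by (auto simp: doubleton_eq_iff)
  then have "?S \<inter> tri i j k = {}"
    by (auto simp: tri_def)
  then have "?S \<inter> inside (tri i j k) = {}"
    using connected_subset_inside[OF closed_tri[OF d], of ?S] connected_arc_minus_start[OF A(1)] A(2)
      outer[OF d] \<open>a l \<in> ?S\<close> by auto
  moreover have "a i \<in> tri i j k"
    using arcs[of i j] lt pathstart_in_path_image[of "g i j"] by (auto simp: tri_def)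
  then have "a i \<notin> inside (tri i j k)"
    by (rule on_not_inside)
  ultimately show ?thesis by blast
qed

text \<open>One side of \<open>tri i j l\<close> lies on \<open>tri i j k\<close>, and the other two
  are spokes to \<open>l\<close>.\<close>

lemma edges_not_inside:
  assumes d: "distinct4 i j k l"
  shows "tri i j l \<inter> inside (tri i j k) = {}"
proof -
  have "distinct4 j k i l"
    using d by (auto simp: distinct4_def)
  then have "path_image (g j l) \<inter> inside (tri i j k) = {}"
    using spoke_not_inside[of j k i l] tri_rotate[of i j k] by simp
  moreover have "path_image (g l i) \<inter> inside (tri i j k) = {}"
    using spoke_not_inside[OF d] image_sym[of l i] by simp
  moreover have "path_image (g i j) \<inter> inside (tri i j k) = {}"
  proof -
    have "path_image (g i j) \<subseteq> tri i j k"
      by (auto simp: tri_def)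
    then show ?thesis
      using on_not_inside[of _ "tri i j k"] by blast
  qed
  ultimately show ?thesis
    by (auto simp: tri_def)
qed

text \<open>If the insides of two triangles meet, then they coincide, as each is connected and misses
  the other triangle. But then so do the triangles, as the frontiers of their insides.\<close>

lemma insides_disjoint:
  assumes d: "distinct4 i j k l"
  shows "inside (tri i j k) \<inter> inside (tri i j l) = {}"
proof (rule ccontr)
  assume meets: "inside (tri i j k) \<inter> inside (tri i j l) \<noteq> {}"
  have d': "distinct4 i j l k"
    using d by (auto simp: distinct4_def)
  have "inside (tri i j k) \<subseteq> inside (tri i j l)"
    using connected_subset_inside[OF closed_tri[OF d'] tri_Jordan(2)[OF d]] edges_not_inside[OF d] meets by auto
  moreover have "inside (tri i j l) \<subseteq> inside (tri i j k)"
    using connected_subset_inside[OF closed_tri[OF d] tri_Jordan(2)[OF d']] edges_not_inside[OF d'] meets by auto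
  ultimately have "frontier (inside (tri i j l)) = frontier (inside (tri i j k))"
    by (intro arg_cong[where f = frontier] equalityI)
  then have "tri i j l = tri i j k"
    unfolding tri_Jordan(3)[OF d] tri_Jordan(3)[OF d'] .
  have lt: "i < 4" "j < 4" "k < 4" "l < 4" "i \<noteq> j" "j \<noteq> k" "k \<noteq> i" "i \<noteq> l" "j \<noteq> l" "k \<noteq> l"
    using d by (auto simp: distinct4_def)
  have on: "a l \<in> path_image (g m l)" if "m < 4" "m \<noteq> l" for m
    using arcs[of m l] lt(4) that by (metis pathfinish_in_path_image)
  then have "a l \<in> tri i j l"
    using lt by (auto simp: tri_def)
  then have "a l \<in> tri i j k"
    using \<open>tri i j l = tri i j k\<close> by simp
  \<comment> \<open>The point \<open>a l\<close> lies on all three spokes, but each side of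
    \<open>tri i j k\<close> is disjoint from the spoke at the opposite corner.\<close>
  then show False
    using meet[of i j k l] meet[of j k i l] meet[of k i j l] lt on[of i] on[of j] on[of k]
    by (auto simp: tri_def doubleton_eq_iff)
qed

text \<open>The boundaries of the four triangles, suitably oriented, cancel. Hence a point inside one
  triangle, where its winding number is non-zero, is inside another one as well.\<close>

lemma contradiction: False
proof -
  \<comment> \<open>The last two facts rotate the triangle 0 1 2, so that results about the common
    side \<open>i j\<close> apply to each of its sides.\<close>
  have d: "distinct4 0 1 2 3" "distinct4 0 1 3 2" "distinct4 1 2 3 0" "distinct4 2 0 3 1"
    "distinct4 1 2 0 3" "distinct4 2 0 1 3"
    by (auto simp: distinct4_def)
  obtain z where z: "z \<in> inside (tri 0 1 2)"
    using tri_Jordan(1)[OF d(1)] by blast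
  have rot: "tri 1 2 0 = tri 0 1 2" "tri 2 0 1 = tri 0 1 2"
    using tri_rotate by metis+
  have off: "z \<notin> tri 0 1 2" "z \<notin> tri 0 1 3" "z \<notin> tri 1 2 3" "z \<notin> tri 2 0 3"
    using on_not_inside[of z "tri 0 1 2"] z edges_not_inside[OF d(1)] edges_not_inside[OF d(5)]
      edges_not_inside[OF d(6)] rot by auto
  have "z \<notin> inside (tri 0 1 3)" "z \<notin> inside (tri 1 2 3)" "z \<notin> inside (tri 2 0 3)"
    using z insides_disjoint[OF d(1)] insides_disjoint[OF d(5)] insides_disjoint[OF d(6)] rot by auto
  then have zero: "winding_number (loop 0 1 3) z = 0" "winding_number (loop 1 2 3) z = 0"
    "winding_number (loop 2 0 3) z = 0"
    using winding_loop(2)[OF d(2) off(2)] winding_loop(2)[OF d(3) off(3)] winding_loop(2)[OF d(4) off(4)]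
    by auto
  have rev: "winding_number (g j i) z = - winding_number (g i j) z"
    if "i < 4" "j < 4" "i \<noteq> j" "z \<notin> path_image (g i j)" for i j
    using that arcs[of i j] by (simp add: rev_arc[of i j] winding_number_reversepath arc_imp_path)
  have "winding_number (g 3 0) z = - winding_number (g 0 3) z"
    "winding_number (g 3 1) z = - winding_number (g 1 3) z"
    "winding_number (g 3 2) z = - winding_number (g 2 3) z"
    using off rev[of 0 3] rev[of 1 3] rev[of 2 3] by (auto simp: tri_def)
  \<comment> \<open>The loops 0 1 3, 1 2 3 and 2 0 3 run through each spoke to 3 once in either
    direction, so their winding numbers add up to that of the loop 0 1 2.\<close>
  then have "winding_number (loop 0 1 2) z = 0"
    using zero winding_loop(1)[OF d(1) off(1)] winding_loop(1)[OF d(2) off(2)]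
      winding_loop(1)[OF d(3) off(3)] winding_loop(1)[OF d(4) off(4)] by (simp add: algebra_simps)
  then show False
    using winding_loop(2)[OF d(1) off(1)] z by simp
qed

end

section \<open>From a K4 minor to a K4 subdivision\<close>

definition simple_walk :: "('a \<Rightarrow> 'a \<Rightarrow> bool) \<Rightarrow> 'a \<Rightarrow> 'a list \<Rightarrow> 'a \<Rightarrow> bool" where
  "simple_walk R x xs y \<longleftrightarrow> xs \<noteq> [] \<and> hd xs = x \<and> last xs = y \<and> distinct xs \<and> successively R xs"

lemma simple_walk_rev:
  assumes "symp R" "simple_walk R x xs y"
  shows "simple_walk R y (rev xs) x"
proof -
  have "successively (\<lambda>x y. R y x) xs"
    by (rule successively_mono[of R]) (use assms in \<open>auto simp: simple_walk_def dest: sympD\<close>)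
  then show ?thesis
    using assms(2) by (auto simp: simple_walk_def hd_rev last_rev)
qed

lemma simple_walk_prefix: "simple_walk R x (xs @ z # ys) y \<Longrightarrow> simple_walk R x (xs @ [z]) z"
  by (auto simp: simple_walk_def successively_append_iff hd_append)

lemma simple_walk_suffix: "simple_walk R x (xs @ z # ys) y \<Longrightarrow> simple_walk R z (z # ys) y"
  by (auto simp: simple_walk_def successively_append_iff)

lemma simple_walk_append:
  assumes "simple_walk R x xs y" "simple_walk R z zs w" "R y z" "set xs \<inter> set zs = {}"
  shows "simple_walk R x (xs @ zs) w"
  using assms by (auto simp: simple_walk_def successively_append_iff)

lemma rtranclp_simple_walk:
  assumes "R\<^sup>*\<^sup>* x y"
  shows "\<exists>xs. simple_walk R x xs y"
  using assms
proof (induction rule: rtranclp_induct)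
  case base
  show ?case
    by (rule exI[of _ "[x]"]) (simp add: simple_walk_def)
next
  case (step y z)
  then obtain xs where xs: "simple_walk R x xs y"
    by blast
  show ?case
  proof (cases "z \<in> set xs")
    \<comment> \<open>If the new vertex has been visited before, the walk is cut off there instead
      of being prolonged.\<close>
    case True
    then obtain ys zs where "xs = ys @ z # zs"
      by (auto dest: split_list)
    then show ?thesis
      using xs simple_walk_prefix by metis
  next
    case False
    then have "simple_walk R x (xs @ [z]) z"
      using xs step(2) by (auto simp: simple_walk_def successively_append_iff hd_append)
    then show ?thesis by blast
  qed
qed

lemma connected_in_simple_walk:
  assumes "connected_in R B" "x \<in> B" "y \<in> B"
  shows "\<exists>xs. simple_walk R x xs y \<and> set xs \<subseteq> B"
proof -
  let ?r = "\<lambda>u v. R u v \<and> u \<in> B \<and> v \<in> B"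
  have "?r\<^sup>*\<^sup>* x y"
    using assms by (simp add: connected_in_def)
  then obtain xs where xs: "simple_walk ?r x xs y"
    using rtranclp_simple_walk by metis
  then have "successively ?r xs"
    by (simp add: simple_walk_def)
  \<comment> \<open>The restricted relation places only ends of steps in \<open>B\<close>; a walk of
    one vertex has no step, hence \<open>insert x B\<close>.\<close>
  then have "successively R xs" "set xs \<subseteq> insert x B"
    using xs by (auto simp: simple_walk_def successively_conv_nth in_set_conv_nth hd_conv_nth)
       (metis (no_types, lifting) Suc_pred less_Suc_eq_0_disj not_less_eq nat_neq_iff Suc_lessI Suc_less_eq)+
  then show ?thesis
    using xs assms(2) by (auto simp: simple_walk_def)
qed

text \<open>Walk from \<open>t3\<close> towards \<open>t1\<close> and stop at the first vertex
  \<open>r\<close> on a path from \<open>t1\<close> to \<open>t2\<close>; the path splits at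
  \<open>r\<close> into two legs. Legs may consist of \<open>r\<close> alone.\<close>

lemma tripod:
  assumes R: "symp R" and B: "connected_in R B" and t: "t1 \<in> B" "t2 \<in> B" "t3 \<in> B"
  shows "\<exists>r L1 L2 L3. simple_walk R r L1 t1 \<and> simple_walk R r L2 t2 \<and> simple_walk R r L3 t3 \<and>
    set L1 \<union> set L2 \<union> set L3 \<subseteq> B \<and>
    set L1 \<inter> set L2 \<subseteq> {r} \<and> set L1 \<inter> set L3 \<subseteq> {r} \<and> set L2 \<inter> set L3 \<subseteq> {r}"
proof -
  obtain xs where xs: "simple_walk R t1 xs t2" "set xs \<subseteq> B"
    using connected_in_simple_walk[OF B t(1,2)] by blast
  obtain ys where ys: "simple_walk R t3 ys t1" "set ys \<subseteq> B"
    using connected_in_simple_walk[OF B t(3,1)] by blast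
  have "t1 \<in> set xs" "t1 \<in> set ys"
    using xs(1) ys(1) by (auto simp: simple_walk_def) (metis last_in_set)
  then have "\<exists>r\<in>set ys. r \<in> set xs" by blast
  then obtain ys1 r ys2 where r: "ys = ys1 @ r # ys2" "r \<in> set xs" "\<forall>y\<in>set ys1. y \<notin> set xs"
    using split_list_first_prop[of ys "\<lambda>r. r \<in> set xs"] by blast
  then obtain xs1 xs2 where x12: "xs = xs1 @ r # xs2"
    by (auto dest: split_list)
  have "distinct xs"
    using xs(1) by (simp add: simple_walk_def)
  have "simple_walk R r (rev (xs1 @ [r])) t1" "simple_walk R r (r # xs2) t2" "simple_walk R r (rev (ys1 @ [r])) t3"
    using xs(1) ys(1) unfolding r(1) x12
    by (metis simple_walk_rev[OF R] simple_walk_prefix simple_walk_suffix)+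
  moreover have "set (rev (xs1 @ [r])) \<inter> set (r # xs2) \<subseteq> {r}"
    using \<open>distinct xs\<close> by (auto simp: x12)
  moreover have "set (rev (xs1 @ [r])) \<inter> set (rev (ys1 @ [r])) \<subseteq> {r}" "set (r # xs2) \<inter> set (rev (ys1 @ [r])) \<subseteq> {r}"
    using r(3) by (auto simp: x12)
  moreover have "set (rev (xs1 @ [r])) \<union> set (r # xs2) \<union> set (rev (ys1 @ [r])) \<subseteq> B"
    using xs(2) ys(2) by (auto simp: x12 r(1))
  ultimately show ?thesis by blast
qed

lemma tripod_indexed:
  assumes R: "symp R" and B: "connected_in R B" and J: "card J = 3" and t: "\<And>j. j \<in> J \<Longrightarrow> t j \<in> B"
  shows "\<exists>r L. \<forall>j\<in>J. simple_walk R r (L j) (t j) \<and> set (L j) \<subseteq> B \<and>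
    (\<forall>k\<in>J. j \<noteq> k \<longrightarrow> set (L j) \<inter> set (L k) \<subseteq> {r})"
proof -
  obtain x y z where J: "J = {x, y, z}" and ne: "x \<noteq> y" "y \<noteq> z" "x \<noteq> z"
    using J by (auto simp: card_3_iff)
  then have "t x \<in> B" "t y \<in> B" "t z \<in> B"
    using t by auto
  then obtain r L1 L2 L3 where L: "simple_walk R r L1 (t x)" "simple_walk R r L2 (t y)" "simple_walk R r L3 (t z)"
    "set L1 \<union> set L2 \<union> set L3 \<subseteq> B" "set L1 \<inter> set L2 \<subseteq> {r}" "set L1 \<inter> set L3 \<subseteq> {r}" "set L2 \<inter> set L3 \<subseteq> {r}"
    using tripod[OF R B] by metis
  show ?thesis
    by (rule exI[of _ r], rule exI[of _ "\<lambda>j. if j = x then L1 else if j = y then L2 else L3"])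
       (use L ne in \<open>simp add: J Int_commute\<close>)
qed

definition K4_subdivision :: "('a \<Rightarrow> 'a \<Rightarrow> bool) \<Rightarrow> (nat \<Rightarrow> 'a) \<Rightarrow> (nat \<Rightarrow> nat \<Rightarrow> 'a list) \<Rightarrow> bool" where
  "K4_subdivision R r P \<longleftrightarrow>
     inj_on r {..<4} \<and> (\<forall>i<4. \<forall>j<4. i \<noteq> j \<longrightarrow> simple_walk R (r i) (P i j) (r j)) \<and>
     (\<forall>i<4. \<forall>j<4. \<forall>k<4. \<forall>l<4. i \<noteq> j \<longrightarrow> k \<noteq> l \<longrightarrow> {i, j} \<noteq> {k, l} \<longrightarrow>
        set (P i j) \<inter> set (P k l) \<subseteq> r ` ({i, j} \<inter> {k, l}))"

text \<open>Each vertex of K4 has degree 3, so a branch set only has to link three exits, and a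
  tripod does that. Its centre becomes a vertex of the subdivision.\<close>

lemma K4_minor_subdivision:
  assumes R: "symp R" and "K4_minor V R"
  shows "\<exists>r P. K4_subdivision R r P \<and> (\<forall>i<4. r i \<in> V)"
proof -
  obtain B :: "nat \<Rightarrow> _" where B: "\<And>i. i < 4 \<Longrightarrow> connected_in R (B i)" "\<And>i. i < 4 \<Longrightarrow> B i \<subseteq> V"
    and dis: "\<And>i j. i < 4 \<Longrightarrow> j < 4 \<Longrightarrow> i \<noteq> j \<Longrightarrow> B i \<inter> B j = {}"
    and adj: "\<And>i j. i < 4 \<Longrightarrow> j < 4 \<Longrightarrow> i \<noteq> j \<Longrightarrow> \<exists>x\<in>B i. \<exists>y\<in>B j. R x y"
    using assms(2) unfolding K4_minor_def by blast
  have "\<forall>i j. \<exists>x y. i < 4 \<longrightarrow> j < 4 \<longrightarrow> i \<noteq> j \<longrightarrow> x \<in> B i \<and> y \<in> B j \<and> R x y"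
    using adj by blast
  then obtain s s' where s: "\<And>i j. i < 4 \<Longrightarrow> j < 4 \<Longrightarrow> i \<noteq> j \<Longrightarrow> s i j \<in> B i \<and> s' i j \<in> B j \<and> R (s i j) (s' i j)"
    by metis
  \<comment> \<open>The exit from \<open>B i\<close> towards \<open>B j\<close>. Choosing one edge
    per unordered pair makes \<open>t i j\<close> and \<open>t j i\<close> the two ends of the same
    edge.\<close>
  define t where "t i j = (if i < j then s i j else s' j i)" for i j
  have t: "t i j \<in> B i" "R (t i j) (t j i)" if "i < 4" "j < 4" "i \<noteq> j" for i j
    using s[of i j] s[of j i] that R by (auto simp: t_def dest: sympD)
  have "\<exists>r L. \<forall>j\<in>{..<4} - {i}. simple_walk R r (L j) (t i j) \<and> set (L j) \<subseteq> B i \<and>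
    (\<forall>k\<in>{..<4} - {i}. j \<noteq> k \<longrightarrow> set (L j) \<inter> set (L k) \<subseteq> {r})" if "i < 4" for i
    by (rule tripod_indexed[OF R B(1)[OF that]]) (use t that in auto)
  then have "\<forall>i. \<exists>r L. i < 4 \<longrightarrow> (\<forall>j\<in>{..<4} - {i}. simple_walk R r (L j) (t i j) \<and> set (L j) \<subseteq> B i \<and>
    (\<forall>k\<in>{..<4} - {i}. j \<noteq> k \<longrightarrow> set (L j) \<inter> set (L k) \<subseteq> {r}))"
    by blast
  then obtain r L where "\<forall>i<4. \<forall>j\<in>{..<4} - {i}. simple_walk R (r i) (L i j) (t i j) \<and> set (L i j) \<subseteq> B i \<and>
    (\<forall>k\<in>{..<4} - {i}. j \<noteq> k \<longrightarrow> set (L i j) \<inter> set (L i k) \<subseteq> {r i})"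
    by metis
  then have L: "simple_walk R (r i) (L i j) (t i j)" "set (L i j) \<subseteq> B i"
    "\<And>k. k < 4 \<Longrightarrow> k \<noteq> i \<Longrightarrow> j \<noteq> k \<Longrightarrow> set (L i j) \<inter> set (L i k) \<subseteq> {r i}"
    if "i < 4" "j < 4" "i \<noteq> j" for i j
    using that by auto
  have rB: "r i \<in> B i" if i: "i < 4" for i
  proof -
    obtain j :: nat where "j < 4" "i \<noteq> j"
      by (metis zero_less_numeral one_less_numeral_iff semiring_norm(76) zero_neq_one)
    then show ?thesis
      using L[of i j] i by (metis hd_in_set simple_walk_def subsetD)
  qed
  define P where "P i j = L i j @ rev (L j i)" for i j
  have walks: "simple_walk R (r i) (P i j) (r j)" if "i < 4" "j < 4" "i \<noteq> j" for i j
    unfolding P_def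
  proof (rule simple_walk_append)
    show "simple_walk R (r i) (L i j) (t i j)" "simple_walk R (t j i) (rev (L j i)) (r j)" "R (t i j) (t j i)"
      using L[of i j] L[of j i] that t simple_walk_rev[OF R] by auto
    show "set (L i j) \<inter> set (rev (L j i)) = {}"
      using L(2)[of i j] L(2)[of j i] dis[of i j] that by auto
  qed
  have inj: "inj_on r {..<4}"
    by (rule inj_onI) (metis rB dis disjoint_iff lessThan_iff)
  have meet: "set (P i j) \<inter> set (P k l) \<subseteq> r ` ({i, j} \<inter> {k, l})"
    if lt: "i < 4" "j < 4" "k < 4" "l < 4" "i \<noteq> j" "k \<noteq> l" "{i, j} \<noteq> {k, l}" for i j k l
  proof -
    have leg: "set (L m n) \<inter> set (L m' n') \<subseteq> r ` ({m, n} \<inter> {m', n'})"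
      if "m < 4" "n < 4" "m' < 4" "n' < 4" "m \<noteq> n" "m' \<noteq> n'" "{m, n} \<noteq> {m', n'}" for m n m' n'
    proof (cases "m = m'")
      case True
      then have "set (L m n) \<inter> set (L m' n') \<subseteq> {r m}"
        using L(3)[of m n n'] that by auto
      then show ?thesis using True by auto
    next
      case False
      then show ?thesis
        using L(2)[of m n] L(2)[of m' n'] dis[of m m'] that by auto
    qed
    \<comment> \<open>Each path consists of two legs. Legs in different branch sets are disjoint,
      and different legs in the same set share at most the centre.\<close>
    have "set (P i j) \<inter> set (P k l) = set (L i j) \<inter> set (L k l) \<union> set (L i j) \<inter> set (L l k) \<union>
        set (L j i) \<inter> set (L k l) \<union> set (L j i) \<inter> set (L l k)"
      by (auto simp: P_def)
    moreover have "{j, i} = {i, j}" "{l, k} = {k, l}"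
      by auto
    ultimately show ?thesis
      using leg[of i j k l] leg[of i j l k] leg[of j i k l] leg[of j i l k] lt
      by (simp only: Un_subset_iff simp_thms not_sym)
  qed
  have "K4_subdivision R r P"
    unfolding K4_subdivision_def by (intro conjI allI impI inj walks meet)
  moreover have "\<forall>i<4. r i \<in> V"
    using rB B(2) by auto
  ultimately show ?thesis
    by (intro exI conjI)
qed

section \<open>From walks in a plane drawing to arcs\<close>

fun walk_edges :: "'a list \<Rightarrow> 'a set set" where
  "walk_edges (x # y # xs) = insert {x, y} (walk_edges (y # xs))"
| "walk_edges xs = {}"

lemma walk_edges_subset: "e \<in> walk_edges xs \<Longrightarrow> e \<subseteq> set xs"
  by (induction xs rule: walk_edges.induct) auto

lemma walk_edges_adjacent: "successively (adjacent E) xs \<Longrightarrow> walk_edges xs \<subseteq> E"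
  by (induction xs rule: walk_edges.induct) auto

context
  fixes G :: "'a graph" and p \<gamma>
  assumes drawing: "plane_drawing G p \<gamma>" and simple: "finite_simple_graph G"
begin

text \<open>The interior of each curve avoids the other curve, so a common point is an end of both,
  and \<open>p\<close> is injective on vertices.\<close>

lemma edge_curves_meet:
  assumes "e \<in> edges G" "f \<in> edges G" "e \<noteq> f"
  shows "path_image (\<gamma> e) \<inter> path_image (\<gamma> f) \<subseteq> p ` (e \<inter> f)"
proof
  fix z assume z: "z \<in> path_image (\<gamma> e) \<inter> path_image (\<gamma> f)"
  have "z \<notin> arc_interior (\<gamma> e)" "z \<notin> arc_interior (\<gamma> f)"
    using drawing assms z unfolding plane_drawing_def by blast+
  then have "z \<in> {pathstart (\<gamma> e), pathfinish (\<gamma> e)}" "z \<in> {pathstart (\<gamma> f), pathfinish (\<gamma> f)}"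
    using z unfolding arc_interior_def by blast+
  moreover have "{pathstart (\<gamma> e), pathfinish (\<gamma> e)} = p ` e" "{pathstart (\<gamma> f), pathfinish (\<gamma> f)} = p ` f"
    using drawing assms unfolding plane_drawing_def by blast+
  ultimately have "z \<in> p ` e \<inter> p ` f" by simp
  moreover have "inj_on p (verts G)" "e \<subseteq> verts G" "f \<subseteq> verts G"
    using drawing simple assms unfolding plane_drawing_def finite_simple_graph_def by blast+
  ultimately show "z \<in> p ` (e \<inter> f)"
    by (simp add: inj_on_image_Int)
qed

text \<open>A drawing does not say in which direction \<open>\<gamma> e\<close> runs, so the curve
  may have to be reversed.\<close>

lemma edge_arc:
  assumes "{x, y} \<in> edges G"
  shows "\<exists>g. arc g \<and> pathstart g = p x \<and> pathfinish g = p y \<and> path_image g = path_image (\<gamma> {x, y})"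
proof -
  have arc: "arc (\<gamma> {x, y})" and ends: "{pathstart (\<gamma> {x, y}), pathfinish (\<gamma> {x, y})} = {p x, p y}"
    using drawing assms unfolding plane_drawing_def by force+
  from ends consider "pathstart (\<gamma> {x, y}) = p x" "pathfinish (\<gamma> {x, y}) = p y"
    | "pathstart (\<gamma> {x, y}) = p y" "pathfinish (\<gamma> {x, y}) = p x"
    by (auto simp: doubleton_eq_iff)
  then show ?thesis
  proof cases
    case 1
    then show ?thesis using arc by blast
  next
    case 2
    then show ?thesis
      using arc by (intro exI[of _ "reversepath (\<gamma> {x, y})"]) (simp add: arc_reversepath)
  qed
qed

lemma walk_arc:
  assumes "successively (adjacent (edges G)) xs" "distinct xs" "2 \<le> length xs"
  shows "\<exists>g. arc g \<and> pathstart g = p (hd xs) \<and> pathfinish g = p (last xs) \<and>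
    path_image g = (\<Union>e\<in>walk_edges xs. path_image (\<gamma> e))"
  using assms
proof (induction xs rule: walk_edges.induct)
  case (1 x y xs)
  obtain e where e: "arc e" "pathstart e = p x" "pathfinish e = p y" "path_image e = path_image (\<gamma> {x, y})"
    using edge_arc[of x y] 1 by auto
  show ?case
  proof (cases "xs = []")
    case True
    then show ?thesis using e by auto
  next
    case False
    then obtain g where g: "arc g" "pathstart g = p y" "pathfinish g = p (last xs)"
      "path_image g = (\<Union>e\<in>walk_edges (y # xs). path_image (\<gamma> e))"
      using 1 by (cases xs) auto
    \<comment> \<open>The first vertex \<open>x\<close> does not recur, so the first curve can meet
      later ones only at \<open>p y\<close>, as joining arcs requires.\<close>
    have "path_image (\<gamma> {x, y}) \<inter> path_image (\<gamma> f) \<subseteq> {p y}" if f: "f \<in> walk_edges (y # xs)" for f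
    proof -
      have "f \<subseteq> set (y # xs)"
        using f by (rule walk_edges_subset)
      then have "x \<notin> f" using 1 by auto
      moreover have "f \<in> edges G" "{x, y} \<in> edges G"
        using 1 f walk_edges_adjacent[of "edges G" "y # xs"] by auto
      ultimately show ?thesis
        using edge_curves_meet[of "{x, y}" f] by auto
    qed
    then have "path_image e \<inter> path_image g \<subseteq> {p y}"
      unfolding e(4) g(4) by blast
    then have "arc (e +++ g)"
      using e g by (intro arc_join) auto
    then show ?thesis
      using e g False by (intro exI[of _ "e +++ g"]) (auto simp: path_image_join)
  qed
qed auto

text \<open>With at most one common vertex the walks have no common edge, so only curves of
  different edges are compared.\<close>

lemma walk_curves_meet:
  assumes "successively (adjacent (edges G)) xs" "successively (adjacent (edges G)) ys"
    and "set xs \<inter> set ys \<subseteq> {v}"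
  shows "(\<Union>e\<in>walk_edges xs. path_image (\<gamma> e)) \<inter> (\<Union>e\<in>walk_edges ys. path_image (\<gamma> e))
    \<subseteq> p ` (set xs \<inter> set ys)"
proof -
  have "path_image (\<gamma> e) \<inter> path_image (\<gamma> f) \<subseteq> p ` (set xs \<inter> set ys)"
    if ef: "e \<in> walk_edges xs" "f \<in> walk_edges ys" for e f
  proof -
    have sub: "e \<subseteq> set xs" "f \<subseteq> set ys"
      using ef by (auto dest: walk_edges_subset)
    have E: "e \<in> edges G" "f \<in> edges G"
      using ef walk_edges_adjacent assms(1,2) by blast+
    have "e \<noteq> f"
    proof
      assume "e = f"
      then have "e \<subseteq> {v}" using sub assms(3) by blast
      then have "card e \<le> 1" using card_mono[of "{v}" e] by simp
      then show False using simple E unfolding finite_simple_graph_def by force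
    qed
    then show ?thesis
      using edge_curves_meet[OF E] sub by blast
  qed
  then show ?thesis by blast
qed

text \<open>Since \<open>inside T\<close> is open, a point in it on the boundary of the outer face
  would make it meet the outer face, which is part of \<open>outside T\<close>.\<close>

lemma outer_vertex_not_inside:
  assumes "p v \<in> frontier (outside (drawing_points G p \<gamma>))" "T \<subseteq> drawing_points G p \<gamma>" "closed T"
  shows "p v \<notin> inside T"
proof
  assume "p v \<in> inside T"
  moreover have "p v \<in> closure (outside (drawing_points G p \<gamma>))"
    using assms(1) by (simp add: frontier_def)
  ultimately have "inside T \<inter> outside (drawing_points G p \<gamma>) \<noteq> {}"
    using open_inside[OF assms(3)] open_Int_closure_eq_empty by blast
  then show False
    using outside_mono[OF assms(2)] inside_Int_outside by blast
qed

end

lemma outerplanar_no_K4_minor: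
  fixes G :: "'a graph"
  assumes simple: "finite_simple_graph G" and "outerplanar G"
  shows "\<not> K4_minor (\<Union>(edges G)) (adjacent (edges G))"
proof
  let ?E = "edges G"
  assume "K4_minor (\<Union>?E) (adjacent ?E)"
  from K4_minor_subdivision[OF symp_adjacent this]
  obtain r P where rP: "K4_subdivision (adjacent ?E) r P" and r: "\<forall>i<4. r i \<in> \<Union>?E"
    by (elim exE conjE)
  have inj: "inj_on r {..<4}"
    and walk: "\<And>i j. i < 4 \<Longrightarrow> j < 4 \<Longrightarrow> i \<noteq> j \<Longrightarrow> simple_walk (adjacent ?E) (r i) (P i j) (r j)"
    and meet: "\<And>i j k l. i < 4 \<Longrightarrow> j < 4 \<Longrightarrow> k < 4 \<Longrightarrow> l < 4 \<Longrightarrow> i \<noteq> j \<Longrightarrow> k \<noteq> l \<Longrightarrow> {i, j} \<noteq> {k, l} \<Longrightarrow>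
        set (P i j) \<inter> set (P k l) \<subseteq> r ` ({i, j} \<inter> {k, l})"
    using rP by (simp_all add: K4_subdivision_def)
  obtain p \<gamma> where drawing: "plane_drawing G p \<gamma>"
    and outer: "\<And>v. v \<in> verts G \<Longrightarrow> p v \<in> frontier (outside (drawing_points G p \<gamma>))"
    using \<open>outerplanar G\<close> unfolding outerplanar_def by blast
  define I where "I i j = (\<Union>e\<in>walk_edges (P i j). path_image (\<gamma> e))" for i j
  have rne: "r i \<noteq> r j" if "i < 4" "j < 4" "i \<noteq> j" for i j
    using inj that by (auto dest: inj_onD)
  have "\<exists>h. arc h \<and> pathstart h = p (r i) \<and> pathfinish h = p (r j) \<and> path_image h = I i j"
    if ij: "i < 4" "j < 4" "i \<noteq> j" for i j
  proof -
    have w: "P i j \<noteq> []" "hd (P i j) = r i" "last (P i j) = r j" "distinct (P i j)" "successively (adjacent ?E) (P i j)"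
      using walk[OF ij] by (auto simp: simple_walk_def)
    have "2 \<le> length (P i j)"
    proof (rule ccontr)
      assume "\<not> 2 \<le> length (P i j)"
      then have "length (P i j) = 1" using w(1) by (cases "P i j") (auto simp: Suc_le_eq)
      then show False using w(2,3) rne[OF ij] by (auto simp: length_Suc_conv)
    qed
    then show ?thesis
      using walk_arc[OF drawing simple w(5,4)] w(2,3) by (simp add: I_def)
  qed
  then have "\<forall>i j. \<exists>h. i < 4 \<and> j < 4 \<and> i \<noteq> j \<longrightarrow>
      arc h \<and> pathstart h = p (r i) \<and> pathfinish h = p (r j) \<and> path_image h = I i j"
    by blast
  then obtain h where h: "\<And>i j. i < 4 \<Longrightarrow> j < 4 \<Longrightarrow> i \<noteq> j \<Longrightarrow>
      arc (h i j) \<and> pathstart (h i j) = p (r i) \<and> pathfinish (h i j) = p (r j) \<and> path_image (h i j) = I i j"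
    by metis
  \<comment> \<open>The arcs \<open>h i j\<close> and \<open>h j i\<close> were chosen
    independently. Keeping the one with increasing indices and reversing it gives
    \<open>rev_arc\<close>.\<close>
  define g where "g i j = (if i \<le> j then h i j else reversepath (h j i))" for i j
  have gh: "arc (g i j) \<and> pathstart (g i j) = p (r i) \<and> pathfinish (g i j) = p (r j)"
    if "i < 4" "j < 4" "i \<noteq> j" for i j
    using h[of i j] h[of j i] that by (auto simp: g_def arc_reversepath)
  have gI: "path_image (g i j) = I i j \<or> path_image (g i j) = I j i" if "i < 4" "j < 4" "i \<noteq> j" for i j
    using h[of i j] h[of j i] that by (auto simp: g_def)
  have I_meet: "I i j \<inter> I k l \<subseteq> (\<lambda>i. p (r i)) ` ({i, j} \<inter> {k, l})"
    if lt: "i < 4" "j < 4" "k < 4" "l < 4" "i \<noteq> j" "k \<noteq> l" "{i, j} \<noteq> {k, l}" for i j k l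
  proof -
    \<comment> \<open>Different pairs of indices share at most one index, so the two walks have at
      most one common vertex.\<close>
    have "\<exists>v. r ` ({i, j} \<inter> {k, l}) \<subseteq> {v}"
      using lt by (auto simp: doubleton_eq_iff)
    then obtain v where "set (P i j) \<inter> set (P k l) \<subseteq> {v}"
      using meet[OF lt] by (meson order_trans)
    then have "I i j \<inter> I k l \<subseteq> p ` (set (P i j) \<inter> set (P k l))"
      unfolding I_def using walk[of i j] walk[of k l] lt
      by (intro walk_curves_meet[OF drawing simple]) (auto simp: simple_walk_def)
    also have "\<dots> \<subseteq> p ` r ` ({i, j} \<inter> {k, l})"
      using meet[OF lt] by (rule image_mono)
    finally show ?thesis
      by (simp add: image_image)
  qed
  interpret K4_arcs "\<lambda>i. p (r i)" g
  proof
    fix i j k l :: nat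
    show "i < 4 \<Longrightarrow> j < 4 \<Longrightarrow> i \<noteq> j \<Longrightarrow> arc (g i j) \<and> pathstart (g i j) = p (r i) \<and> pathfinish (g i j) = p (r j)"
      by (rule gh)
    assume lt: "i < 4" "j < 4" "k < 4" "l < 4" "i \<noteq> j" "k \<noteq> l" "{i, j} \<noteq> {k, l}"
    let ?X = "(\<lambda>i. p (r i)) ` ({i, j} \<inter> {k, l})"
    have "I i j \<inter> I k l \<subseteq> ?X" "I j i \<inter> I k l \<subseteq> ?X" "I i j \<inter> I l k \<subseteq> ?X" "I j i \<inter> I l k \<subseteq> ?X"
      using I_meet[of i j k l] I_meet[of j i k l] I_meet[of i j l k] I_meet[of j i l k] lt
      by (simp_all add: insert_commute)
    then show "path_image (g i j) \<inter> path_image (g k l) \<subseteq> ?X"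
      using gI[OF lt(1,2,5)] gI[OF lt(3,4,6)] by metis
  next
    fix i j :: nat
    show "i \<noteq> j \<Longrightarrow> g j i = reversepath (g i j)"
      by (simp add: g_def)
  qed
  interpret outer_K4_arcs "\<lambda>i. p (r i)" g
  proof
    fix i j k l assume d: "distinct4 i j k l"
    then have lt: "i < 4" "j < 4" "k < 4" "l < 4" "i \<noteq> j" "j \<noteq> k" "k \<noteq> i"
      by (auto simp: distinct4_def)
    have "I m n \<subseteq> drawing_points G p \<gamma>" if "m < 4" "n < 4" "m \<noteq> n" for m n
      using walk[OF that] walk_edges_adjacent[of ?E "P m n"]
      by (auto simp: I_def drawing_points_def simple_walk_def)
    then have "path_image (g m n) \<subseteq> drawing_points G p \<gamma>" if "m < 4" "n < 4" "m \<noteq> n" for m n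
      using gI[of m n] that by metis
    then have "tri i j k \<subseteq> drawing_points G p \<gamma>"
      unfolding tri_def using lt by simp
    moreover have "r l \<in> verts G"
      using r lt(4) simple by (auto simp: finite_simple_graph_def)
    ultimately show "p (r l) \<notin> inside (tri i j k)"
      using outer_vertex_not_inside[OF drawing simple outer _ closed_tri[OF d]] by blast
  qed
  show False
    by (rule contradiction)
qed

section \<open>Packing colourings\<close>

lemma adjacent_line_graph:
  "{e, f} \<in> edges (line_graph G) \<longleftrightarrow> e \<in> edges G \<and> f \<in> edges G \<and> e \<noteq> f \<and> e \<inter> f \<noteq> {}"
proof
  assume "{e, f} \<in> edges (line_graph G)"
  then obtain e' f' where "{e, f} = {e', f'}" and ef: "e' \<in> edges G" "f' \<in> edges G" "e' \<noteq> f'" "e' \<inter> f' \<noteq> {}"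
    unfolding line_graph_def snd_conv by blast
  then have "e = e' \<and> f = f' \<or> e = f' \<and> f = e'"
    by (simp add: doubleton_eq_iff)
  then show "e \<in> edges G \<and> f \<in> edges G \<and> e \<noteq> f \<and> e \<inter> f \<noteq> {}"
    using ef by blast
next
  assume "e \<in> edges G \<and> f \<in> edges G \<and> e \<noteq> f \<and> e \<inter> f \<noteq> {}"
  then show "{e, f} \<in> edges (line_graph G)"
    unfolding line_graph_def snd_conv by blast
qed

lemma edge_dist_ge_2:
  assumes "e \<noteq> f" "e \<inter> f = {}"
  shows "enat 2 \<le> edge_dist G e f"
  unfolding edge_dist_def graph_dist_def
proof (rule INF_greatest)
  fix xs assume "xs \<in> {xs. walk_between (line_graph G) e xs f}"
  then have xs: "xs \<noteq> []" "hd xs = e" "last xs = f"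
    "successively (\<lambda>x y. {x, y} \<in> edges (line_graph G)) xs"
    by (auto simp: walk_between_def)
  have "length xs \<noteq> 1"
    using xs(2,3) assms(1) by (auto simp: length_Suc_conv)
  moreover have "length xs \<noteq> 2"
    using xs(2-4) assms(2) by (auto simp: numeral_2_eq_2 length_Suc_conv adjacent_line_graph)
  moreover have "length xs \<noteq> 0"
    using xs(1) by simp
  ultimately have "2 \<le> length xs - 1"
    by linarith
  then show "enat 2 \<le> enat (length xs - 1)"
    by simp
qed

lemma edge_dist_ge_3:
  assumes "finite_simple_graph G" "e \<noteq> f" "e \<inter> f = {}"
    and far: "\<And>x y. x \<in> e \<Longrightarrow> y \<in> f \<Longrightarrow> {x, y} \<notin> edges G"
  shows "enat 3 \<le> edge_dist G e f"
  unfolding edge_dist_def graph_dist_def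
proof (rule INF_greatest)
  fix xs assume "xs \<in> {xs. walk_between (line_graph G) e xs f}"
  then have xs: "xs \<noteq> []" "hd xs = e" "last xs = f"
    "successively (\<lambda>x y. {x, y} \<in> edges (line_graph G)) xs"
    by (auto simp: walk_between_def)
  have "length xs \<noteq> 0" "length xs \<noteq> 1"
    using xs(1-3) assms(2) by (auto simp: length_Suc_conv)
  moreover have "length xs \<noteq> 2"
    using xs(2-4) assms(3) by (auto simp: numeral_2_eq_2 length_Suc_conv adjacent_line_graph)
  \<comment> \<open>On a walk \<open>e\<close>, \<open>g\<close>, \<open>f\<close> the middle edge
    would join the disjoint edges \<open>e\<close> and \<open>f\<close>.\<close>
  moreover have "length xs \<noteq> 3"
  proof
    assume "length xs = 3"
    then obtain g where "xs = [e, g, f]"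
      using xs(2,3) by (auto simp: numeral_3_eq_3 length_Suc_conv)
    then have g: "g \<in> edges G" "e \<inter> g \<noteq> {}" "g \<inter> f \<noteq> {}"
      using xs(4) by (auto simp: adjacent_line_graph)
    then obtain x y where xy: "x \<in> e" "x \<in> g" "y \<in> g" "y \<in> f"
      by blast
    then have "x \<noteq> y" using assms(3) by blast
    moreover have "card g = 2"
      using assms(1) g(1) by (auto simp: finite_simple_graph_def)
    ultimately have "g = {x, y}"
      using xy by (auto simp: card_2_iff)
    then show False using far xy g(1) by blast
  qed
  ultimately have "3 \<le> length xs - 1"
    by linarith
  then show "enat 3 \<le> enat (length xs - 1)"
    by simp
qed

lemma degree_eq_card_nbrs:
  assumes "\<forall>e\<in>edges G. card e = 2"
  shows "degree G x = card (nbrs (edges G) x)"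
proof -
  have "inj_on (\<lambda>y. {x, y}) (nbrs (edges G) x)"
    by (auto simp: inj_on_def doubleton_eq_iff)
  then show ?thesis
    by (simp add: degree_def star_eq[OF assms] card_image)
qed

lemma outerplanar_subcubic_K4_free:
  assumes "finite_simple_graph G" "subcubic G" "outerplanar G"
  shows "subcubic_K4_free (edges G)"
proof -
  have G: "finite (verts G)" "\<forall>e\<in>edges G. card e = 2" "\<forall>e\<in>edges G. e \<subseteq> verts G"
    using assms(1) by (auto simp: finite_simple_graph_def)
  then have "edges G \<subseteq> Pow (verts G)"
    by blast
  then have "finite (edges G)"
    using G(1) by (meson finite_Pow_iff finite_subset)
  moreover have "card (nbrs (edges G) x) \<le> 3" for x
  proof (cases "x \<in> verts G")
    case True
    then show ?thesis
      using assms(2) degree_eq_card_nbrs[OF G(2)] by (simp add: subcubic_def)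
  next
    case False
    then have "nbrs (edges G) x = {}"
      using G(3) by (auto simp: nbrs_def)
    then show ?thesis by simp
  qed
  ultimately show ?thesis
    using G(2) outerplanar_no_K4_minor[OF assms(1,3)] by (simp add: subcubic_K4_free_def)
qed

text \<open>For the edges of a matching this is adjacency after contracting them.\<close>

definition joined :: "'a set set \<Rightarrow> 'a set \<Rightarrow> 'a set \<Rightarrow> bool" where
  "joined E e f \<longleftrightarrow> e \<noteq> f \<and> (\<exists>x\<in>e. \<exists>y\<in>f. {x, y} \<in> E)"

text \<open>Each edge of \<open>M\<close> is its own branch set. So a set \<open>W\<close> without
  an element of degree at most 2 would, by Dirac's theorem, yield a K4 minor of
  \<open>E\<close>.\<close>

lemma matching_joined_3_colouring:
  assumes good: "subcubic_K4_free E" and M: "M \<subseteq> E" "\<forall>e\<in>M. \<forall>f\<in>M. e \<noteq> f \<longrightarrow> e \<inter> f = {}"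
  shows "\<exists>h::'a set \<Rightarrow> nat. (\<forall>e\<in>M. h e < 3) \<and> (\<forall>e\<in>M. \<forall>f\<in>M. e \<noteq> f \<longrightarrow> joined E e f \<longrightarrow> h e \<noteq> h f)"
proof (rule degenerate_3_colouring)
  have E: "finite E" "\<forall>e\<in>E. card e = 2" "\<not> K4_minor (\<Union>E) (adjacent E)"
    using good by (auto simp: subcubic_K4_free_def)
  show "finite M"
    using E(1) M(1) finite_subset by blast
  show "symp (joined E)"
    unfolding symp_def joined_def by (metis insert_commute)
  fix W assume W: "W \<subseteq> M" "W \<noteq> {}"
  have irrefl: "irreflp (joined E)"
    by (simp add: irreflp_def joined_def)
  show "\<exists>e\<in>W. card {f \<in> W. joined E e f} \<le> 2"
  proof (rule ccontr)
    assume "\<not> ?thesis"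
    then have "3 \<le> card {f \<in> W. joined E e f}" if "e \<in> W" for e
      using that by (auto simp: not_le)
    then have minor: "K4_minor W (joined E)"
      using min_degree_3_K4_minor[OF finite_subset[OF W(1) \<open>finite M\<close>] W(2) \<open>symp (joined E)\<close> irrefl] by blast
    have "K4_minor (\<Union>E) (adjacent E)"
    proof (rule K4_minor_model[OF minor, where \<phi> = "\<lambda>e. e"])
      fix e assume e: "e \<in> W"
      then have "e \<in> E" using W(1) M(1) by blast
      then obtain x y where xy: "e = {x, y}" "{x, y} \<in> E"
        using E(2) by (metis card_2_iff)
      then have "connected_in (adjacent E) e"
        by (intro connected_in_star[OF symp_adjacent, of x]) auto
      then show "connected_in (adjacent E) e \<and> e \<subseteq> \<Union>E"
        using \<open>e \<in> E\<close> by blast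
      fix f assume "f \<in> W"
      then show "e \<inter> f = {}" if "e \<noteq> f"
        using that e W(1) M(2) by blast
      show "\<exists>x\<in>e. \<exists>y\<in>f. {x, y} \<in> E" if "joined E e f"
        using that by (simp add: joined_def)
    qed
    with E(3) show False ..
  qed
qed

text \<open>An edge inside the union of \<open>I\<close> either joins two members, which is
  excluded, or has both ends in one member and equals it.\<close>

lemma unjoined_induced_matching:
  assumes "finite_simple_graph G" "matching G I"
    and unjoined: "\<And>e f. e \<in> I \<Longrightarrow> f \<in> I \<Longrightarrow> \<not> joined (edges G) e f"
  shows "induced_matching G I"
proof -
  have "e \<in> I" if e: "e \<in> edges G" "e \<subseteq> \<Union>I" for e
  proof -
    have "card e = 2"
      using assms(1) e by (auto simp: finite_simple_graph_def)
    then obtain x y where xy: "e = {x, y}" "x \<noteq> y"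
      by (auto simp: card_2_iff)
    then obtain f g where fg: "f \<in> I" "g \<in> I" "x \<in> f" "y \<in> g"
      using e by auto
    then have "f = g"
      using unjoined[of f g] e xy by (auto simp: joined_def)
    moreover have "card f = 2"
      using assms(1,2) fg by (auto simp: finite_simple_graph_def matching_def)
    ultimately have "f = e"
      using fg xy by (auto simp: card_2_iff)
    then show ?thesis using fg by simp
  qed
  moreover have "I \<subseteq> edges G"
    using assms(2) by (simp add: matching_def)
  ultimately show ?thesis
    using assms(2) unfolding induced_matching_def by blast
qed

theorem corollary3p3:
  fixes G :: "'a graph"
  assumes "finite_simple_graph G" and "subcubic G" and "outerplanar G"
  shows "packing_edge_colorable G (replicate 2 1 @ replicate 3 2) \<and>
    (\<exists>M\<^sub>1 M\<^sub>2 I\<^sub>1 I\<^sub>2 I\<^sub>3. edge_partition G [M\<^sub>1, M\<^sub>2, I\<^sub>1, I\<^sub>2, I\<^sub>3] \<and>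
       matching G M\<^sub>1 \<and> matching G M\<^sub>2 \<and>
       induced_matching G I\<^sub>1 \<and> induced_matching G I\<^sub>2 \<and> induced_matching G I\<^sub>3)"
proof -
  have good: "subcubic_K4_free (edges G)"
    using outerplanar_subcubic_K4_free[OF assms] .
  then obtain c where c: "edge_3_colouring (edges G) c"
    using subcubic_K4_free_edge_3_colouring by blast
  define M where "M k = {e \<in> edges G. c e = k}" for k
  have disjoint: "e \<inter> f = {}" if "e \<in> M k" "f \<in> M k" "e \<noteq> f" for e f k
    using c that by (auto simp: M_def edge_3_colouring_def)
  then have matching: "matching G (M k)" for k
    by (auto simp: matching_def M_def)
  have M2: "M 2 \<subseteq> edges G" "\<forall>e\<in>M 2. \<forall>f\<in>M 2. e \<noteq> f \<longrightarrow> e \<inter> f = {}"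
    using disjoint by (auto simp: M_def)
  obtain h :: "'a set \<Rightarrow> nat" where h: "\<forall>e\<in>M 2. h e < 3"
    "\<forall>e\<in>M 2. \<forall>f\<in>M 2. e \<noteq> f \<longrightarrow> joined (edges G) e f \<longrightarrow> h e \<noteq> h f"
    using matching_joined_3_colouring[OF good M2] by (elim exE conjE)
  define I where "I k = {e \<in> M 2. h e = k}" for k
  have unjoined: "\<not> joined (edges G) e f" if "e \<in> I k" "f \<in> I k" for e f k
  proof
    assume "joined (edges G) e f"
    moreover from this have "e \<noteq> f"
      by (simp add: joined_def)
    moreover have "e \<in> M 2" "f \<in> M 2" "h e = h f"
      using that by (simp_all add: I_def)
    ultimately show False
      using h(2) by blast
  qed
  have "matching G (I k)" for k
    unfolding matching_def I_def using M2 by blast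
  then have induced: "induced_matching G (I k)" for k
    using unjoined_induced_matching[OF assms(1)] unjoined by blast
  let ?Es = "[M 0, M 1, I 0, I 1, I 2]"
  have lt3: "n < 3 \<Longrightarrow> n = 0 \<or> n = 1 \<or> n = 2" for n :: nat
    by linarith
  have "\<Union>(set ?Es) = edges G"
  proof
    show "\<Union>(set ?Es) \<subseteq> edges G"
      by (auto simp: M_def I_def)
    show "edges G \<subseteq> \<Union>(set ?Es)"
    proof
      fix e assume e: "e \<in> edges G"
      then have "c e = 0 \<or> c e = 1 \<or> c e = 2"
        using c lt3 by (simp add: edge_3_colouring_def)
      moreover have "h e = 0 \<or> h e = 1 \<or> h e = 2" if "c e = 2"
        using h(1) lt3 e that by (simp add: M_def)
      ultimately show "e \<in> \<Union>(set ?Es)"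
        using e by (auto simp: M_def I_def)
    qed
  qed
  moreover have "disjoint_family_on (\<lambda>i. ?Es ! i) {..<length ?Es}"
    by (auto simp: M_def I_def disjoint_family_on_def less_Suc_eq numeral_eq_Suc)
  ultimately have partition: "edge_partition G ?Es"
    unfolding edge_partition_def by blast
  let ?S = "replicate 2 1 @ replicate 3 2 :: nat list"
  have S: "?S = [1, 1, 2, 2, 2]"
    by (simp add: numeral_2_eq_2 numeral_3_eq_3)
  \<comment> \<open>The required distances exceed the entries of the sequence by one: disjointness
    gives 2, and the absence of a joining edge gives 3.\<close>
  have M_dist: "enat (1 + 1) \<le> edge_dist G e f" if "e \<in> M k" "f \<in> M k" "e \<noteq> f" for e f k
    using edge_dist_ge_2[OF that(3) disjoint[OF that]] by (simp add: numeral_2_eq_2)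
  have I_dist: "enat (2 + 1) \<le> edge_dist G e f" if "e \<in> I k" "f \<in> I k" "e \<noteq> f" for e f k
  proof -
    have "e \<inter> f = {}"
      using that disjoint[of e 2 f] by (auto simp: I_def)
    then have "enat 3 \<le> edge_dist G e f"
      using edge_dist_ge_3[OF assms(1) that(3)] unjoined[OF that(1,2)] that(3) by (auto simp: joined_def)
    then show ?thesis by simp
  qed
  have "packing_edge_coloring G ?S ?Es"
    unfolding packing_edge_coloring_def S
  proof (intro conjI allI impI ballI)
    fix i e f assume "i < length [1::nat, 1, 2, 2, 2]" and e: "e \<in> ?Es ! i" and f: "f \<in> ?Es ! i" and "e \<noteq> f"
    then have "i = 0 \<or> i = 1 \<or> i = 2 \<or> i = 3 \<or> i = 4"
      by simp linarith
    then show "enat ([1, 1, 2, 2, 2] ! i + 1) \<le> edge_dist G e f"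
      using e f M_dist[OF _ _ \<open>e \<noteq> f\<close>] I_dist[OF _ _ \<open>e \<noteq> f\<close>] by auto
  qed (use partition in auto)
  then have "packing_edge_colorable G ?S"
    unfolding packing_edge_colorable_def by blast
  then show ?thesis
    using partition matching induced by blast
qed

end
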